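(* Let $\mathcal G\curvearrowright X$ and $\mathcal H\curvearrowright Y$ be pseudogroups acting on locally compact Polish spaces, and suppose there is an equivalence $\Phi\colon(X,\mathcal G)\to(Y,\mathcal H)$. Then: (1) $\mathcal G$ is sensitive to initial conditions if and only if $\mathcal H$ is; (2) $\mathcal G$ has density of periodic orbits if and only if $\mathcal H$ does; (3) $\mathcal G$ is chaotic (in the sense of Devaney) if and only if $\mathcal H$ is; (4) $\mathcal G$ is almost equicontinuous if and only if $\mathcal H$ is.
   Context: Metrics may take the value $\infty$; a metric is compatible if its open balls generate the topology. $\mathrm{Ph}(X,Y)$ is the set of partial homeomorphisms from $X$ to $Y$, i.e. homeomorphisms $f\colon\mathrm{dom} f\to\mathrm{im} f$ with $\mathrm{dom} f\subset X$, $\mathrm{im} f\subset Y$ open; $\mathrm{Ph}(X)=\mathrm{Ph}(X,X)$. The composition $gf$ has domain $f^{-1}(\mathrm{dom}\,g)$, and $f(A)$ means $f(A\cap\mathrm{dom} f)$. A pseudo$*$group on $X$ is a subset of $\mathrm{Ph}(X)$ containing $\mathrm{id}_X$ and closed under inversion, composition and restriction to open subsets of domains. A pseudogroup $\mathcal G\curvearrowright X$ is a pseudo$*$group such that if $f\in\mathrm{Ph}(X)$ and every $x\in\mathrm{dom} f$ has an open neighborhood $U_x$ with $f|_{U_x}\in\mathcal G$, then $f\in\mathcal G$. $S\subset\mathcal G$ generates $\mathcal G$ if $\mathcal G$ is the smallest pseudogroup containing $S$; $S^*$ denotes the smallest pseudo$*$group containing $S$. The orbit of $x$ is $\mathcal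 Gx=\{gx\mid g\in\mathcal G,\ x\in\mathrm{dom}\,g\}$. For open $U\subset X$, $\mathcal G|_U=\{f\in\mathcal G\mid\mathrm{dom} f,\mathrm{im} f\subset U\}$. An equivalence $\Phi\colon(X,\mathcal G)\to(Y,\mathcal H)$ is a set $\Phi\subset\mathrm{Ph}(X,Y)$ such that: (i) the domains of elements of $\Phi$ cover $X$ and the images cover $Y$; (ii) $\Phi$ is closed under restriction to open subsets of domains; (iii) if $\phi\in\mathrm{Ph}(X,Y)$ and $\mathrm{dom}\,\phi$ has an open cover $\{U_i\}$ with $\phi|_{U_i}\in\Phi$ for all $i$, then $\phi\in\Phi$; (iv) $h\phi g\in\Phi$ for $g\in\mathcal G$, $h\in\mathcal H$, $\phi\in\Phi$; (v) if $\phi,\psi\in\Phi$ then $\psi^{-1}\phi\in\mathcal G$ and $\psi\phi^{-1}\in\mathcal H$. $\mathcal G$ is sensitive to initial conditions if for every compatible metric $d$ on $X$ and every pseudo$*$group $\mathcal S\subset\mathcal G$ generating $\mathcal G$ there is $c>0$ such that for every $x\in X$ and $r>0$ there are $s\in\mathcal S$ and $y$ with $x,y\in\mathrm{dom}\,s$, $d(x,y)<r$ and $d(sx,sy)\ge c$. $\mathcal G$ has density of periodic orbits if there is an open $U\subset X$ meeting every $\mathcal G$-orbit such that the union of the finite $\mathcal G|_U$-orbits is dense in $U$. $\mathcal G$ is topologically transitive if for all non-empty open $U,V\subset X$ there is $g\in\mathcal G$ with $g(U)\cap V\ne\emptyset$. $\mathcal G$ is chaotic if it is topologically transitive, has density of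 periodic orbits and is sensitive to initial conditions. For a generating set $S$ and compatible metric $d$, a point $x$ is $(S,d)$-equicontinuous if for every $\epsilon>0$ there is $\delta(\epsilon)>0$ such that $d(x,y)<\delta(\epsilon)$ implies $d(s(x),s(y))<\epsilon$ for every $s\in S^*$ and $y\in X$ with $x,y\in\mathrm{dom}\,s$. $\mathcal G$ is almost equicontinuous if there are a generating set $S$ and a compatible metric $d$ such that the $(S,d)$-equicontinuous points are dense in $X$. *)

theory Defs
  imports "HOL-Analysis.Analysis"
begin

definition locally_compact_Polish :: "'a topology \<Rightarrow> bool" where
  "locally_compact_Polish X \<longleftrightarrow>
     locally_compact_space X \<and> completely_metrizable_space X \<and> separable_space X"


section \<open>Metrics with values in \<open>[0, \<infinity>]\<close>\<close>

definition ext_metric_on :: "'a set \<Rightarrow> ('a \<Rightarrow> 'a \<Rightarrow> ennreal) \<Rightarrow> bool" where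
  "ext_metric_on A d \<longleftrightarrow>
     (\<forall>x\<in>A. \<forall>y\<in>A. d x y = 0 \<longleftrightarrow> x = y) \<and>
     (\<forall>x\<in>A. \<forall>y\<in>A. d x y = d y x) \<and>
     (\<forall>x\<in>A. \<forall>y\<in>A. \<forall>z\<in>A. d x z \<le> d x y + d y z)"

definition ext_ball :: "'a set \<Rightarrow> ('a \<Rightarrow> 'a \<Rightarrow> ennreal) \<Rightarrow> 'a \<Rightarrow> real \<Rightarrow> 'a set" where
  "ext_ball A d x r = {y\<in>A. d x y < ennreal r}"

definition compatible_metric :: "'a topology \<Rightarrow> ('a \<Rightarrow> 'a \<Rightarrow> ennreal) \<Rightarrow> bool" where
  "compatible_metric X d \<longleftrightarrow>
     ext_metric_on (topspace X) d \<and>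
     X = topology_generated_by {ext_ball (topspace X) d x r | x r. x \<in> topspace X \<and> 0 < r}"


section \<open>Partial homeomorphisms\<close>

text \<open>
  A partial map is a term of type \<open>'a \<rightharpoonup> 'b\<close>, so that two partial maps with the same domain and
  the same values are equal. The composition \<open>g f\<close>, with domain the preimage of \<open>dom g\<close> under \<open>f\<close>,
  is \<open>g \<circ>\<^sub>m f\<close>, the restriction of \<open>f\<close> to \<open>U\<close> is \<open>f |` U\<close>, and the image of \<open>f\<close> is \<open>ran f\<close>.
\<close>

definition pid :: "'a topology \<Rightarrow> 'a \<rightharpoonup> 'a" where
  "pid X = Some |` topspace X"

definition pinv :: "('a \<rightharpoonup> 'b) \<Rightarrow> 'b \<rightharpoonup> 'a" where
  "pinv f = (\<lambda>y. if y \<in> ran f then Some (THE x. f x = Some y) else None)"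

definition pimage :: "('a \<rightharpoonup> 'b) \<Rightarrow> 'a set \<Rightarrow> 'b set" where
  "pimage f A = {y. \<exists>x\<in>A. f x = Some y}"

definition Ph :: "'a topology \<Rightarrow> 'b topology \<Rightarrow> ('a \<rightharpoonup> 'b) set" where
  "Ph X Y = {f. openin X (dom f) \<and> openin Y (ran f) \<and>
     homeomorphic_map (subtopology X (dom f)) (subtopology Y (ran f)) (\<lambda>x. the (f x))}"


section \<open>Pseudo*groups and pseudogroups\<close>

definition pseudostargroup :: "'a topology \<Rightarrow> ('a \<rightharpoonup> 'a) set \<Rightarrow> bool" where
  "pseudostargroup X G \<longleftrightarrow>
     G \<subseteq> Ph X X \<and>
     pid X \<in> G \<and>
     (\<forall>f\<in>G. pinv f \<in> G) \<and>
     (\<forall>f\<in>G. \<forall>g\<in>G. g \<circ>\<^sub>m f \<in> G) \<and>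
     (\<forall>f\<in>G. \<forall>U. openin X U \<and> U \<subseteq> dom f \<longrightarrow> f |` U \<in> G)"

definition pseudogroup :: "'a topology \<Rightarrow> ('a \<rightharpoonup> 'a) set \<Rightarrow> bool" where
  "pseudogroup X G \<longleftrightarrow>
     pseudostargroup X G \<and>
     (\<forall>f\<in>Ph X X.
        (\<forall>x\<in>dom f. \<exists>U. openin X U \<and> x \<in> U \<and> U \<subseteq> dom f \<and> f |` U \<in> G) \<longrightarrow> f \<in> G)"

text \<open>
  Both kinds of structure are closed under intersections of non-empty families, so the hull
  (the intersection of all such structures containing \<open>S\<close>) is the smallest one containing \<open>S\<close>
  whenever \<open>S \<subseteq> Ph X X\<close>.
\<close>

definition generates :: "'a topology \<Rightarrow> ('a \<rightharpoonup> 'a) set \<Rightarrow> ('a \<rightharpoonup> 'a) set \<Rightarrow> bool" where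
  "generates X S G \<longleftrightarrow> S \<subseteq> G \<and> pseudogroup X hull S = G"

definition star :: "'a topology \<Rightarrow> ('a \<rightharpoonup> 'a) set \<Rightarrow> ('a \<rightharpoonup> 'a) set" where
  "star X S = pseudostargroup X hull S"

definition orbit :: "('a \<rightharpoonup> 'a) set \<Rightarrow> 'a \<Rightarrow> 'a set" where
  "orbit G x = {y. \<exists>g\<in>G. g x = Some y}"

definition prestrict :: "('a \<rightharpoonup> 'a) set \<Rightarrow> 'a set \<Rightarrow> ('a \<rightharpoonup> 'a) set" where
  "prestrict G U = {f\<in>G. dom f \<subseteq> U \<and> ran f \<subseteq> U}"

definition pseudogroup_equivalence ::
  "'a topology \<Rightarrow> ('a \<rightharpoonup> 'a) set \<Rightarrow> 'b topology \<Rightarrow> ('b \<rightharpoonup> 'b) set \<Rightarrow> ('a \<rightharpoonup> 'b) set \<Rightarrow> bool" where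
  "pseudogroup_equivalence X G Y H \<Phi> \<longleftrightarrow>
     \<Phi> \<subseteq> Ph X Y \<and>
     (\<Union>\<phi>\<in>\<Phi>. dom \<phi>) = topspace X \<and> (\<Union>\<phi>\<in>\<Phi>. ran \<phi>) = topspace Y \<and>
     (\<forall>\<phi>\<in>\<Phi>. \<forall>U. openin X U \<and> U \<subseteq> dom \<phi> \<longrightarrow> \<phi> |` U \<in> \<Phi>) \<and>
     (\<forall>\<phi>\<in>Ph X Y. \<forall>\<U>. (\<forall>U\<in>\<U>. openin X U) \<and> \<Union>\<U> = dom \<phi> \<and> (\<forall>U\<in>\<U>. \<phi> |` U \<in> \<Phi>)
        \<longrightarrow> \<phi> \<in> \<Phi>) \<and>
     (\<forall>g\<in>G. \<forall>h\<in>H. \<forall>\<phi>\<in>\<Phi>. h \<circ>\<^sub>m \<phi> \<circ>\<^sub>m g \<in> \<Phi>) \<and>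
     (\<forall>\<phi>\<in>\<Phi>. \<forall>\<psi>\<in>\<Phi>. pinv \<psi> \<circ>\<^sub>m \<phi> \<in> G \<and> \<psi> \<circ>\<^sub>m pinv \<phi> \<in> H)"


section \<open>Dynamical properties\<close>

definition sensitive :: "'a topology \<Rightarrow> ('a \<rightharpoonup> 'a) set \<Rightarrow> bool" where
  "sensitive X G \<longleftrightarrow>
     (\<forall>d S. compatible_metric X d \<and> pseudostargroup X S \<and> generates X S G \<longrightarrow>
        (\<exists>c::real. 0 < c \<and>
           (\<forall>x\<in>topspace X. \<forall>r::real. 0 < r \<longrightarrow>
              (\<exists>s\<in>S. \<exists>y. x \<in> dom s \<and> y \<in> dom s \<and> d x y < ennreal r \<and>
                 ennreal c \<le> d (the (s x)) (the (s y))))))"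

definition density_of_periodic_orbits :: "'a topology \<Rightarrow> ('a \<rightharpoonup> 'a) set \<Rightarrow> bool" where
  "density_of_periodic_orbits X G \<longleftrightarrow>
     (\<exists>U. openin X U \<and> (\<forall>x\<in>topspace X. orbit G x \<inter> U \<noteq> {}) \<and>
        subtopology X U closure_of
          (\<Union>{orbit (prestrict G U) x | x. x \<in> U \<and> finite (orbit (prestrict G U) x)}) = U)"

definition topologically_transitive :: "'a topology \<Rightarrow> ('a \<rightharpoonup> 'a) set \<Rightarrow> bool" where
  "topologically_transitive X G \<longleftrightarrow>
     (\<forall>U V. openin X U \<and> U \<noteq> {} \<and> openin X V \<and> V \<noteq> {} \<longrightarrow>
        (\<exists>g\<in>G. pimage g U \<inter> V \<noteq> {}))"

definition chaotic :: "'a topology \<Rightarrow> ('a \<rightharpoonup> 'a) set \<Rightarrow> bool" where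
  "chaotic X G \<longleftrightarrow>
     topologically_transitive X G \<and> density_of_periodic_orbits X G \<and> sensitive X G"

definition equicontinuous_point ::
  "'a topology \<Rightarrow> ('a \<rightharpoonup> 'a) set \<Rightarrow> ('a \<Rightarrow> 'a \<Rightarrow> ennreal) \<Rightarrow> 'a \<Rightarrow> bool" where
  "equicontinuous_point X S d x \<longleftrightarrow>
     (\<forall>\<epsilon>::real. 0 < \<epsilon> \<longrightarrow>
        (\<exists>\<delta>::real. 0 < \<delta> \<and>
           (\<forall>s\<in>star X S. \<forall>y\<in>topspace X. x \<in> dom s \<and> y \<in> dom s \<and> d x y < ennreal \<delta> \<longrightarrow>
              d (the (s x)) (the (s y)) < ennreal \<epsilon>)))"

definition almost_equicontinuous :: "'a topology \<Rightarrow> ('a \<rightharpoonup> 'a) set \<Rightarrow> bool" where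
  "almost_equicontinuous X G \<longleftrightarrow>
     (\<exists>S d. generates X S G \<and> compatible_metric X d \<and>
        X closure_of {x \<in> topspace X. equicontinuous_point X S d x} = topspace X)"

end

theory Submission
  imports Defs
begin

text \<open>
  An equivalence \<open>\<Phi>\<close> identifies orbits of \<open>G\<close> with orbits of \<open>H\<close>, and it can be inverted, so for each
  property one implication suffices. Topological transitivity is transported directly by
  conjugation with members of \<open>\<Phi>\<close>.

  For density of periodic orbits, cover \<open>X\<close> by a locally finite family of open sets \<open>A n\<close>, each inside
  the domain of some \<open>\<phi> n\<close> in \<open>\<Phi>\<close>. If \<open>U\<close> witnesses the property for \<open>G\<close>, then the union \<open>V\<close> of the
  sets \<open>\<phi> n (A n \<inter> U)\<close> witnesses it for \<open>H\<close>: a point of a finite orbit in \<open>U\<close> has only finitely many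
  images in \<open>V\<close>, because it lies in only finitely many of the \<open>A n\<close>
  (\<open>density_of_periodic_orbits_linked\<close>).

  Sensitivity and almost equicontinuity are both statements about stable points: \<open>x\<close> is stable at
  scale \<open>c\<close> for \<open>(S, d)\<close> if the maps of \<open>S\<close> move points near \<open>x\<close> to within \<open>c\<close> of the image of \<open>x\<close>. A
  pseudogroup fails to be sensitive when some \<open>(S, d)\<close> has stable points at every scale, and it is
  almost equicontinuous when for some \<open>(S, d)\<close> the points stable at all scales are dense. Hence
  everything rests on \<open>stable_points_linked\<close>: any generating pseudo*group \<open>S'\<close> and compatible metric
  \<open>d'\<close> for \<open>H\<close> can be matched by \<open>(S, d)\<close> for \<open>G\<close> such that points corresponding under suitable
  charts in \<open>\<Phi>\<close> inherit stability, with a scale on \<open>Y\<close> that depends only on the scale on \<open>X\<close>.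

  For the metric the charts need not be bi-Lipschitz in any sense, so gluing the pulled back metrics
  along chains of points can produce distance zero between distinct points. Only uniform continuity
  of the inverse charts into \<open>(X, d)\<close> is required, uniformly over all charts. This holds if the
  charts are restricted to pieces \<open>U n\<close> of a locally finite cover whose compact closures lie in
  the domains of the charts, and \<open>d\<close> is a metric of the one-point compactification type: the
  diameters of the \<open>U n\<close> tend to zero, so at any given scale only finitely many charts matter, and
  each is handled by compactness (\<open>metric_with_vanishing_diameters\<close>,
  \<open>metric_controlled_by_charts\<close>).

  For the generators one takes the maps of \<open>G\<close> that every pair of charts transports into \<open>S'\<close>
  (\<open>chart_maps\<close>), together with the restrictions of the identity. Because the cover is locally finite
  and \<open>S'\<close> generates \<open>H\<close>, every member of \<open>G\<close> is locally such a map (\<open>locally_in_chart_maps\<close>).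
\<close>

section \<open>Calculus of partial homeomorphisms\<close>

lemma pmap_eqI: "f = g" if "\<And>x y. f x = Some y \<longleftrightarrow> g x = Some y" for f g :: "'a \<rightharpoonup> 'b"
  using that by (metis ext not_None_eq)

lemma pinv_eq_Some_iff: "pinv f y = Some x \<longleftrightarrow> f x = Some y" if "inj_on f (dom f)"
proof -
  have uniq: "(THE x. f x = Some y) = x" if "f x = Some y" for x
    using that \<open>inj_on f (dom f)\<close> by (metis (mono_tags, lifting) domI inj_onD the_equality)
  then show ?thesis
    unfolding pinv_def ran_def by auto
qed

lemma restrict_eq_Some_iff: "(f |` U) x = Some y \<longleftrightarrow> x \<in> U \<and> f x = Some y"
  by (simp add: restrict_map_def)

lemma pid_eq_Some_iff: "pid X x = Some y \<longleftrightarrow> x = y \<and> x \<in> topspace X"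
  by (auto simp: pid_def restrict_map_def)

lemma pimage_iff: "y \<in> pimage f A \<longleftrightarrow> (\<exists>x\<in>A. f x = Some y)"
  by (simp add: pimage_def)

lemmas pmap_simps = map_comp_Some_iff restrict_eq_Some_iff pid_eq_Some_iff pimage_iff

text \<open>
  This form of the definition is symmetric in \<open>f\<close> and its inverse, since images under \<open>pinv f\<close>
  are preimages under \<open>f\<close>.
\<close>
lemma Ph_iff:
  "f \<in> Ph X Y \<longleftrightarrow> inj_on f (dom f) \<and> dom f \<subseteq> topspace X \<and> ran f \<subseteq> topspace Y \<and>
     (\<forall>U. openin X U \<longrightarrow> openin Y (pimage f U)) \<and>
     (\<forall>V. openin Y V \<longrightarrow> openin X (pimage (pinv f) V))" (is "_ \<longleftrightarrow> ?R")
proof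
  assume "f \<in> Ph X Y"
  then have op: "openin X (dom f)" "openin Y (ran f)"
    and hom: "homeomorphic_map (subtopology X (dom f)) (subtopology Y (ran f)) (\<lambda>x. the (f x))"
    by (auto simp: Ph_def)
  have sub: "dom f \<subseteq> topspace X" "ran f \<subseteq> topspace Y"
    using op openin_subset by auto
  have "inj_on (\<lambda>x. the (f x)) (dom f)"
    using homeomorphic_imp_injective_map[OF hom] sub by (simp add: Int_absorb1)
  then have inj: "inj_on f (dom f)"
    by (metis (mono_tags, lifting) inj_on_def)
  have "openin Y (pimage f U)" if "openin X U" for U
  proof -
    have "openin (subtopology X (dom f)) (U \<inter> dom f)"
      using that by (simp add: openin_subtopology_Int)
    then have "openin (subtopology Y (ran f)) ((\<lambda>x. the (f x)) ` (U \<inter> dom f))"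
      using homeomorphic_map_openness_eq[OF hom] by blast
    moreover have "(\<lambda>x. the (f x)) ` (U \<inter> dom f) = pimage f U"
      by (force simp: pimage_def)
    ultimately show ?thesis
      using op(2) openin_trans_full by metis
  qed
  moreover have "openin X (pimage (pinv f) V)" if "openin Y V" for V
  proof -
    have "openin (subtopology Y (ran f)) (V \<inter> ran f)"
      using that by (simp add: openin_subtopology_Int)
    then have "openin (subtopology X (dom f))
        {x \<in> topspace (subtopology X (dom f)). the (f x) \<in> V \<inter> ran f}"
      using homeomorphic_imp_continuous_map[OF hom] openin_continuous_map_preimage by blast
    moreover have "{x \<in> topspace (subtopology X (dom f)). the (f x) \<in> V \<inter> ran f} = pimage (pinv f) V"
      using sub by (force simp: pimage_def pinv_eq_Some_iff[OF inj] ran_def)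
    ultimately show ?thesis
      using op(1) openin_trans_full by metis
  qed
  ultimately show ?R
    using inj sub by blast
next
  assume R: ?R
  then have inj: "inj_on f (dom f)"
    by blast
  have ran: "ran f = pimage f (topspace X)" and dom: "dom f = pimage (pinv f) (topspace Y)"
    using R by (auto simp: ran_def dom_def pimage_def pinv_eq_Some_iff)
  then have op: "openin X (dom f)" "openin Y (ran f)"
    using R by auto
  have top: "topspace (subtopology X (dom f)) = dom f" "topspace (subtopology Y (ran f)) = ran f"
    using R by auto
  have "homeomorphic_map (subtopology X (dom f)) (subtopology Y (ran f)) (\<lambda>x. the (f x))"
  proof (rule bijective_open_imp_homeomorphic_map)
    show "continuous_map (subtopology X (dom f)) (subtopology Y (ran f)) (\<lambda>x. the (f x))"
      unfolding continuous_map
    proof (intro conjI allI impI)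
      fix V assume "openin (subtopology Y (ran f)) V"
      then have "openin Y V"
        using op(2) openin_trans_full by blast
      then have "openin X (pimage (pinv f) V)"
        using R by blast
      moreover have "{x \<in> dom f. the (f x) \<in> V} = pimage (pinv f) V"
        by (force simp: pimage_def pinv_eq_Some_iff[OF inj])
      ultimately show "openin (subtopology X (dom f))
          {x \<in> topspace (subtopology X (dom f)). the (f x) \<in> V}"
        unfolding top openin_open_subtopology[OF op(1)] by auto
    qed (use top in \<open>auto simp: ran_def\<close>)
    show "open_map (subtopology X (dom f)) (subtopology Y (ran f)) (\<lambda>x. the (f x))"
      unfolding open_map_def
    proof (intro allI impI)
      fix U assume U: "openin (subtopology X (dom f)) U"
      then have "U \<subseteq> dom f" "openin X U"
        by (auto simp: openin_open_subtopology[OF op(1)])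
      then have "openin Y (pimage f U)"
        using R by blast
      moreover have "(\<lambda>x. the (f x)) ` U = pimage f U"
        using \<open>U \<subseteq> dom f\<close> by (force simp: pimage_def)
      ultimately show "openin (subtopology Y (ran f)) ((\<lambda>x. the (f x)) ` U)"
        using op(2) by (auto simp: openin_open_subtopology pimage_def ran_def)
    qed
    show "(\<lambda>x. the (f x)) ` topspace (subtopology X (dom f)) = topspace (subtopology Y (ran f))"
      unfolding top by (force simp: ran_def)
    show "inj_on (\<lambda>x. the (f x)) (topspace (subtopology X (dom f)))"
      unfolding top
    proof (rule inj_onI)
      fix x x' assume "x \<in> dom f" "x' \<in> dom f" "the (f x) = the (f x')"
      then show "x = x'"
        by (intro inj_onD[OF inj]) auto
    qed
  qed
  with op show "f \<in> Ph X Y"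
    by (simp add: Ph_def)
qed

lemma Ph_inj: "f \<in> Ph X Y \<Longrightarrow> inj_on f (dom f)"
  and Ph_dom: "f \<in> Ph X Y \<Longrightarrow> dom f \<subseteq> topspace X"
  and Ph_ran: "f \<in> Ph X Y \<Longrightarrow> ran f \<subseteq> topspace Y"
  and Ph_openin_pimage: "f \<in> Ph X Y \<Longrightarrow> openin X U \<Longrightarrow> openin Y (pimage f U)"
  and Ph_openin_preimage: "f \<in> Ph X Y \<Longrightarrow> openin Y V \<Longrightarrow> openin X (pimage (pinv f) V)"
  by (auto simp: Ph_iff)

lemma Ph_openin_dom: "f \<in> Ph X Y \<Longrightarrow> openin X (dom f)"
  by (simp add: Ph_def)

lemma Ph_SomeD: "f \<in> Ph X Y \<Longrightarrow> f x = Some y \<Longrightarrow> x \<in> topspace X \<and> y \<in> topspace Y"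
  using Ph_dom Ph_ran by (fastforce intro: ranI)

lemma Ph_pinv_iff: "f \<in> Ph X Y \<Longrightarrow> pinv f y = Some x \<longleftrightarrow> f x = Some y"
  by (simp add: Ph_inj pinv_eq_Some_iff)

lemma Ph_eq: "f \<in> Ph X Y \<Longrightarrow> f x = Some y \<Longrightarrow> f x' = Some y \<Longrightarrow> x' = x"
  by (metis Ph_pinv_iff option.inject)

lemma inj_pinv: "inj_on (pinv f) (dom (pinv f))" if "inj_on f (dom f)"
proof (rule inj_onI)
  fix y y' assume "y \<in> dom (pinv f)" "y' \<in> dom (pinv f)" "pinv f y = pinv f y'"
  then show "y = y'"
    using that by (metis domD pinv_eq_Some_iff option.inject)
qed

lemma pinv_pinv: "f \<in> Ph X Y \<Longrightarrow> pinv (pinv f) = f"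
  by (intro pmap_eqI) (simp add: Ph_inj inj_pinv pinv_eq_Some_iff)

lemma Ph_pinv: "pinv f \<in> Ph Y X" if f: "f \<in> Ph X Y"
proof -
  have "dom (pinv f) = ran f" "ran (pinv f) = dom f"
    using f by (auto simp: dom_def ran_def Ph_pinv_iff)
  with f show ?thesis
    unfolding Ph_iff[of "pinv f"]
    using inj_pinv[OF Ph_inj[OF f]] pinv_pinv[OF f] by (simp add: Ph_dom Ph_ran
        Ph_openin_pimage Ph_openin_preimage)
qed

lemma pinv_comp: "pinv (g \<circ>\<^sub>m f) = pinv f \<circ>\<^sub>m pinv g"
  if "inj_on f (dom f)" "inj_on g (dom g)"
proof (rule pmap_eqI)
  have "inj_on (g \<circ>\<^sub>m f) (dom (g \<circ>\<^sub>m f))"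
  proof (rule inj_onI)
    fix x x' assume "x \<in> dom (g \<circ>\<^sub>m f)" "x' \<in> dom (g \<circ>\<^sub>m f)" and eq: "(g \<circ>\<^sub>m f) x = (g \<circ>\<^sub>m f) x'"
    then obtain y y' z where "f x = Some y" "f x' = Some y'" "g y = Some z" "g y' = Some z"
      by (fastforce simp: map_comp_Some_iff)
    then show "x = x'"
      using that by (metis domI inj_onD)
  qed
  then show "pinv (g \<circ>\<^sub>m f) z = Some x \<longleftrightarrow> (pinv f \<circ>\<^sub>m pinv g) z = Some x" for z x
    using that by (auto simp: map_comp_Some_iff pinv_eq_Some_iff)
qed

lemma Ph_comp: "g \<circ>\<^sub>m f \<in> Ph X Z" if f: "f \<in> Ph X Y" and g: "g \<in> Ph Y Z"
proof -
  have img: "pimage (g \<circ>\<^sub>m f) U = pimage g (pimage f U)"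
    "pimage (pinv (g \<circ>\<^sub>m f)) V = pimage (pinv f) (pimage (pinv g) V)" for U V
    using f g by (auto simp: pimage_def pinv_comp Ph_inj map_comp_Some_iff)
  show ?thesis
    unfolding Ph_iff img
  proof (intro conjI allI impI)
    show "inj_on (g \<circ>\<^sub>m f) (dom (g \<circ>\<^sub>m f))"
      using f g by (fastforce intro!: inj_onI simp: map_comp_Some_iff dest: Ph_eq)
    show "dom (g \<circ>\<^sub>m f) \<subseteq> topspace X" "ran (g \<circ>\<^sub>m f) \<subseteq> topspace Z"
      using Ph_SomeD[OF f] Ph_SomeD[OF g] by (fastforce simp: ran_def map_comp_Some_iff)+
  qed (use f g in \<open>auto intro: Ph_openin_pimage Ph_openin_preimage\<close>)
qed

lemma Ph_pid: "pid X \<in> Ph X X"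
proof -
  have inj: "inj_on (pid X) (dom (pid X))"
    by (auto simp: inj_on_def pid_def)
  have "pimage (pid X) U = U" "pimage (pinv (pid X)) U = U" if "openin X U" for U
    using openin_subset[OF that] by (auto simp: pimage_iff pinv_eq_Some_iff[OF inj] pid_eq_Some_iff)
  with inj show ?thesis
    by (auto simp: Ph_iff ran_def pid_eq_Some_iff)
qed

lemma Ph_restrict: "f |` U \<in> Ph X Y" if f: "f \<in> Ph X Y" and U: "openin X U"
proof -
  have inj: "inj_on (f |` U) (dom (f |` U))"
    by (rule inj_onI) (use Ph_eq[OF f] in \<open>auto simp: restrict_map_def split: if_splits\<close>)
  have img: "pimage (f |` U) A = pimage f (A \<inter> U)"
    "pimage (pinv (f |` U)) B = pimage (pinv f) B \<inter> U" for A B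
    using f by (auto simp: pimage_def restrict_eq_Some_iff pinv_eq_Some_iff[OF inj] Ph_pinv_iff)
  show ?thesis
    unfolding Ph_iff img
  proof (intro conjI allI impI)
    show "dom (f |` U) \<subseteq> topspace X" "ran (f |` U) \<subseteq> topspace Y"
      using Ph_SomeD[OF f] by (fastforce simp: ran_def restrict_eq_Some_iff)+
  qed (use f U inj in \<open>auto intro: Ph_openin_pimage Ph_openin_preimage\<close>)
qed

lemma pinv_restrict:
  "f \<in> Ph X Y \<Longrightarrow> openin X U \<Longrightarrow> pinv (f |` U) = pinv f |` pimage f U"
  by (intro pmap_eqI)
     (auto simp: Ph_pinv_iff[OF Ph_restrict] Ph_pinv_iff restrict_eq_Some_iff pimage_iff dest: Ph_eq)

section \<open>Pseudo*groups and the pseudogroups they generate\<close>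

lemma pseudostargroupD:
  assumes "pseudostargroup X S"
  shows "S \<subseteq> Ph X X" "pid X \<in> S" "f \<in> S \<Longrightarrow> pinv f \<in> S" "f \<in> S \<Longrightarrow> g \<in> S \<Longrightarrow> g \<circ>\<^sub>m f \<in> S"
  using assms by (auto simp: pseudostargroup_def)

lemma pseudostargroup_restrict:
  assumes S: "pseudostargroup X S" and f: "f \<in> S" and U: "openin X U"
  shows "f |` U \<in> S"
proof -
  have "openin X (U \<inter> dom f)"
    using pseudostargroupD(1)[OF S] f U by (blast intro: Ph_openin_dom)
  then have "f |` (U \<inter> dom f) \<in> S"
    using S f by (simp add: pseudostargroup_def)
  moreover have "f |` (U \<inter> dom f) = f |` U"
    by (rule pmap_eqI) (auto simp: restrict_eq_Some_iff)
  ultimately show ?thesis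
    by simp
qed

lemma pseudostargroup_empty: "pseudostargroup X S \<Longrightarrow> Map.empty \<in> S"
  using pseudostargroup_restrict[of X S "pid X" "{}"] pseudostargroupD(2)[of X S] by simp

lemma pseudogroup_imp_pseudostargroup: "pseudogroup X G \<Longrightarrow> pseudostargroup X G"
  by (simp add: pseudogroup_def)

lemmas pseudogroupD = pseudostargroupD[OF pseudogroup_imp_pseudostargroup]
lemmas pseudogroup_restrict = pseudostargroup_restrict[OF pseudogroup_imp_pseudostargroup]

text \<open>
  Since \<open>f |` U\<close> depends only on the part of \<open>U\<close> in the domain of \<open>f\<close>, for a pseudo*group this is the
  local membership that defines pseudogroups.
\<close>
definition locally_in :: "'a topology \<Rightarrow> ('a \<rightharpoonup> 'b) set \<Rightarrow> ('a \<rightharpoonup> 'b) \<Rightarrow> bool" where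
  "locally_in X S f \<longleftrightarrow> (\<forall>x\<in>dom f. \<exists>U. openin X U \<and> x \<in> U \<and> f |` U \<in> S)"

lemma locally_inE:
  assumes "locally_in X S f" "x \<in> dom f"
  obtains U where "openin X U" "x \<in> U" "f |` U \<in> S"
  using assms(1)[unfolded locally_in_def, rule_format, OF assms(2)] that by auto

lemma pseudogroup_locally_in: "f \<in> G"
  if G: "pseudogroup X G" and f: "f \<in> Ph X X" and loc: "locally_in X G f"
proof -
  have "\<exists>U. openin X U \<and> x \<in> U \<and> U \<subseteq> dom f \<and> f |` U \<in> G" if x: "x \<in> dom f" for x
  proof -
    obtain U where U: "openin X U" "x \<in> U" "f |` U \<in> G"
      using locally_inE[OF loc x] .
    have "f |` (U \<inter> dom f) = f |` U"
      by (rule pmap_eqI) (auto simp: restrict_eq_Some_iff)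
    then show ?thesis
      using U x Ph_openin_dom[OF f] by (metis IntI inf_le2 openin_Int)
  qed
  with G f show ?thesis
    by (auto simp: pseudogroup_def)
qed

lemma pseudogroup_of_locally_in:
  assumes S: "pseudostargroup X S"
  shows "pseudogroup X {f \<in> Ph X X. locally_in X S f}" (is "pseudogroup X ?L")
proof -
  have pid: "pid X \<in> ?L"
    using pseudostargroupD(2)[OF S] pseudostargroup_restrict[OF S] Ph_pid[of X]
    by (auto simp: locally_in_def pid_def)
  have inv: "pinv f \<in> ?L" if "f \<in> ?L" for f
  proof -
    have f: "f \<in> Ph X X" "locally_in X S f"
      using that by auto
    have "\<exists>V. openin X V \<and> y \<in> V \<and> pinv f |` V \<in> S" if y: "y \<in> dom (pinv f)" for y
    proof -
      obtain x where "pinv f y = Some x"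
        using y by auto
      then have x: "f x = Some y"
        by (simp add: Ph_pinv_iff[OF f(1)])
      then obtain U where U: "openin X U" "x \<in> U" "f |` U \<in> S"
        using locally_inE[OF f(2), of x] x by auto
      then have "pinv f |` pimage f U \<in> S"
        using pinv_restrict[OF f(1)] pseudostargroupD(3)[OF S] by metis
      then show ?thesis
        using Ph_openin_pimage[OF f(1)] U x by (intro exI[of _ "pimage f U"]) (auto simp: pimage_iff)
    qed
    then show ?thesis
      using f by (auto simp: locally_in_def intro: Ph_pinv)
  qed
  have comp: "g \<circ>\<^sub>m f \<in> ?L" if "f \<in> ?L" "g \<in> ?L" for f g
  proof -
    have "\<exists>W. openin X W \<and> x \<in> W \<and> (g \<circ>\<^sub>m f) |` W \<in> S" if x: "x \<in> dom (g \<circ>\<^sub>m f)" for x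
    proof -
      obtain y z where y: "f x = Some y" "g y = Some z"
        using x by (auto simp: map_comp_Some_iff)
      have f: "f \<in> Ph X X" "locally_in X S f" and g: "locally_in X S g"
        using \<open>f \<in> ?L\<close> \<open>g \<in> ?L\<close> by auto
      obtain U where U: "openin X U" "x \<in> U" "f |` U \<in> S"
        using locally_inE[OF f(2) domI, OF y(1)] .
      obtain V where V: "openin X V" "y \<in> V" "g |` V \<in> S"
        using locally_inE[OF g domI, OF y(2)] .
      let ?W = "U \<inter> pimage (pinv f) V"
      have "(g \<circ>\<^sub>m f) |` ?W = (g |` V) \<circ>\<^sub>m (f |` U)"
        by (rule pmap_eqI) (auto simp: pmap_simps Ph_pinv_iff[OF f(1)])
      then have "(g \<circ>\<^sub>m f) |` ?W \<in> S"
        using U V pseudostargroupD(4)[OF S] by metis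
      moreover have "openin X ?W" "x \<in> ?W"
        using U V y Ph_openin_preimage[OF f(1)] by (auto simp: pimage_iff Ph_pinv_iff[OF f(1)])
      ultimately show ?thesis
        by blast
    qed
    then show ?thesis
      using that by (auto simp: locally_in_def intro: Ph_comp)
  qed
  have restr: "f |` W \<in> ?L" if "f \<in> ?L" "openin X W" for f W
  proof -
    have "\<exists>U. openin X U \<and> x \<in> U \<and> (f |` W) |` U \<in> S" if x: "x \<in> dom (f |` W)" for x
    proof -
      have "locally_in X S f"
        using \<open>f \<in> ?L\<close> by blast
      moreover have "x \<in> dom f"
        using x unfolding dom_restrict by (rule IntD1)
      ultimately obtain U where U: "openin X U" "x \<in> U" "f |` U \<in> S"
        by (rule locally_inE)
      then have "(f |` U) |` W \<in> S"
        using pseudostargroup_restrict[OF S] \<open>openin X W\<close> by blast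
      then show ?thesis
        using U by (intro exI[of _ U]) (simp add: Int_commute)
    qed
    then show ?thesis
      using that by (auto simp: locally_in_def intro: Ph_restrict)
  qed
  have loc: "f \<in> ?L" if f: "f \<in> Ph X X" 
    and *: "\<forall>x\<in>dom f. \<exists>U. openin X U \<and> x \<in> U \<and> U \<subseteq> dom f \<and> f |` U \<in> ?L" for f
  proof -
    have "\<exists>U. openin X U \<and> x \<in> U \<and> f |` U \<in> S" if x: "x \<in> dom f" for x
    proof -
      obtain U where U: "openin X U" "x \<in> U" "f |` U \<in> ?L"
        using * x by meson
      have "x \<in> dom (f |` U)"
        using x U by auto
      moreover have "locally_in X S (f |` U)"
        using U by simp
      ultimately obtain U' where U': "openin X U'" "x \<in> U'" "(f |` U) |` U' \<in> S"
        using locally_inE[of X S "f |` U" x] by metis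
      then show ?thesis
        using U by (intro exI[of _ "U \<inter> U'"]) (simp add: openin_Int)
    qed
    then show ?thesis
      using f by (auto simp: locally_in_def)
  qed
  have "pseudostargroup X ?L"
    unfolding pseudostargroup_def using pid inv comp restr by blast
  then show ?thesis
    unfolding pseudogroup_def using loc by blast
qed

lemma subset_locally_in:
  assumes "pseudostargroup X S"
  shows "S \<subseteq> {f \<in> Ph X X. locally_in X S f}"
proof
  fix f assume f: "f \<in> S"
  have "f \<in> Ph X X"
    using f pseudostargroupD(1)[OF assms] by blast
  then have "openin X (dom f)" "f |` dom f \<in> S"
    using f pseudostargroup_restrict[OF assms f] Ph_openin_dom by blast+
  then show "f \<in> {f \<in> Ph X X. locally_in X S f}"
    using \<open>f \<in> Ph X X\<close> by (auto simp: locally_in_def)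
qed

text \<open>
  The maps that are locally in a pseudo*group form a pseudogroup, which has to be the generated one.
\<close>
lemma generates_iff_locally_in:
  assumes G: "pseudogroup X G" and S: "pseudostargroup X S"
  shows "generates X S G \<longleftrightarrow> S \<subseteq> G \<and> (\<forall>g\<in>G. locally_in X S g)"
proof
  assume gen: "generates X S G"
  have "pseudogroup X hull S \<subseteq> {f \<in> Ph X X. locally_in X S f}"
    by (intro hull_minimal subset_locally_in pseudogroup_of_locally_in S)
  with gen show "S \<subseteq> G \<and> (\<forall>g\<in>G. locally_in X S g)"
    by (auto simp: generates_def)
next
  assume R: "S \<subseteq> G \<and> (\<forall>g\<in>G. locally_in X S g)"
  have "g \<in> P" if "g \<in> G" "pseudogroup X P" "S \<subseteq> P" for g P
  proof (rule pseudogroup_locally_in[OF \<open>pseudogroup X P\<close>])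
    show "g \<in> Ph X X"
      using that pseudogroupD(1)[OF G] by blast
    show "locally_in X P g"
      using R that unfolding locally_in_def by blast
  qed
  then have "G \<subseteq> pseudogroup X hull S"
    by (auto simp: hull_def)
  moreover have "pseudogroup X hull S \<subseteq> G"
    using R G by (intro hull_minimal) auto
  ultimately show "generates X S G"
    using R by (auto simp: generates_def)
qed

lemma pseudostargroup_star:
  assumes G: "pseudogroup X G" and S: "S \<subseteq> G"
  shows "pseudostargroup X (star X S)" "star X S \<subseteq> G"
proof -
  have mem: "G \<in> {T. pseudostargroup X T \<and> S \<subseteq> T}"
    using G S pseudogroup_imp_pseudostargroup by auto
  then show "star X S \<subseteq> G"
    by (auto simp: star_def hull_def)
  with pseudogroupD(1)[OF G] have "star X S \<subseteq> Ph X X"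
    by blast
  then show "pseudostargroup X (star X S)"
    unfolding pseudostargroup_def star_def hull_def by (auto simp: pseudostargroup_def)
qed

lemma star_idem: "pseudostargroup X S \<Longrightarrow> star X S = S"
  unfolding star_def by (rule hull_same)

lemma generates_star:
  assumes G: "pseudogroup X G" and gen: "generates X S G"
  shows "generates X (star X S) G"
proof -
  have S: "S \<subseteq> G" "pseudogroup X hull S = G"
    using gen by (auto simp: generates_def)
  have "S \<subseteq> star X S"
    unfolding star_def by (rule hull_subset)
  then have "pseudogroup X hull S \<subseteq> pseudogroup X hull (star X S)"
    by (rule hull_mono)
  moreover have "pseudogroup X hull (star X S) \<subseteq> G"
    using G pseudostargroup_star(2)[OF G S(1)] by (rule hull_minimal[rotated])
  ultimately show ?thesis
    using S pseudostargroup_star(2)[OF G S(1)] by (auto simp: generates_def)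
qed

section \<open>Compatible metrics and real-valued metrics\<close>

lemma ext_ball_eq_mball:
  assumes "Metric_space M \<rho>" "x \<in> M"
  shows "ext_ball M (\<lambda>x y. ennreal (\<rho> x y)) x r = Metric_space.mball M \<rho> x r"
proof -
  interpret Metric_space M \<rho>
    by fact
  show ?thesis
    using assms by (auto simp: ext_ball_def mball_def ennreal_less_iff)
qed

lemma compatible_metric_of_Metric_space:
  assumes "Metric_space (topspace X) \<rho>" and top: "Metric_space.mtopology (topspace X) \<rho> = X"
  shows "compatible_metric X (\<lambda>x y. ennreal (\<rho> x y))"
proof -
  interpret Metric_space "topspace X" \<rho>
    by fact
  let ?B = "{mball x r | x r. x \<in> topspace X \<and> 0 < r}"
  have balls: "{ext_ball (topspace X) (\<lambda>x y. ennreal (\<rho> x y)) x r | x r. x \<in> topspace X \<and> 0 < r} = ?B"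
    using ext_ball_eq_mball[OF assms(1)] by blast
  have "generate_topology_on ?B U" if U: "openin X U" for U
  proof -
    have "\<forall>x\<in>U. \<exists>r>0. mball x r \<subseteq> U"
      using U openin_mtopology unfolding top by blast
    then obtain r where r: "\<And>x. x \<in> U \<Longrightarrow> 0 < r x \<and> mball x (r x) \<subseteq> U"
      by metis
    have sub: "U \<subseteq> topspace X"
      using U openin_subset by blast
    have "U = (\<Union>x\<in>U. mball x (r x))"
      using r sub by fastforce
    moreover have "generate_topology_on ?B (\<Union>x\<in>U. mball x (r x))"
      using r sub by (intro generate_topology_on.UN) (blast intro: generate_topology_on.Basis)
    ultimately show ?thesis
      by simp
  qed
  moreover have "openin X U" if "generate_topology_on ?B U" for U
  proof (rule generate_topology_on_coarsest[OF istopology_openin _ that])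
    show "openin X B" if "B \<in> ?B" for B
      using that openin_mball unfolding top by blast
  qed
  ultimately have "X = topology_generated_by ?B"
    unfolding topology_eq openin_topology_generated_by_iff by blast
  moreover have "ext_metric_on (topspace X) (\<lambda>x y. ennreal (\<rho> x y))"
    unfolding ext_metric_on_def
    using commute triangle by (simp add: ennreal_le_iff flip: ennreal_plus)
  ultimately show ?thesis
    unfolding compatible_metric_def balls by simp
qed

text \<open>Truncating an extended metric at 1 gives a real-valued metric with the same small balls.\<close>
lemma compatible_metric_truncate:
  assumes comp: "compatible_metric Y d"
  obtains \<rho> where "Metric_space (topspace Y) \<rho>" "Metric_space.mtopology (topspace Y) \<rho> = Y"
    "\<And>x y c. \<lbrakk>x \<in> topspace Y; y \<in> topspace Y; c \<le> 1\<rbrakk> \<Longrightarrow> d x y < ennreal c \<longleftrightarrow> \<rho> x y < c"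
proof -
  (* The value off the carrier only serves the locale, which asks for symmetry everywhere. *)
  define \<rho> where "\<rho> x y = (if x \<in> topspace Y \<and> y \<in> topspace Y then enn2real (min 1 (d x y)) else 0)"
    for x y
  have ext: "ext_metric_on (topspace Y) d"
    and Y_eq: "Y = topology_generated_by {ext_ball (topspace Y) d x r | x r. x \<in> topspace Y \<and> 0 < r}"
    using comp unfolding compatible_metric_def by blast+
  have gen: "openin Y U \<longleftrightarrow>
      generate_topology_on {ext_ball (topspace Y) d x r | x r. x \<in> topspace Y \<and> 0 < r} U" for U
    by (rule trans[OF arg_cong[OF Y_eq, of "\<lambda>T. openin T U"] openin_topology_generated_by_iff])
  have \<rho>: "ennreal (\<rho> x y) = min 1 (d x y)" if "x \<in> topspace Y" "y \<in> topspace Y" for x y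
  proof -
    have "min 1 (d x y) < top"
      by (simp add: min_less_iff_disj)
    with that show ?thesis
      by (simp add: \<rho>_def)
  qed
  have nonneg: "0 \<le> \<rho> x y" for x y
    by (simp add: \<rho>_def)
  have less: "d x y < ennreal c \<longleftrightarrow> \<rho> x y < c"
    if "x \<in> topspace Y" "y \<in> topspace Y" "c \<le> 1" for x y c
  proof -
    have "\<not> 1 < ennreal c"
      using that by (metis ennreal_1 ennreal_leI not_le)
    then show ?thesis
      using \<rho>[OF that(1,2)] nonneg[of x y] by (metis ennreal_less_iff min_less_iff_disj)
  qed
  have metric: "Metric_space (topspace Y) \<rho>"
  proof
    show "0 \<le> \<rho> x y" for x y
      by (rule nonneg)
    show "\<rho> x y = \<rho> y x" for x y
      using ext by (auto simp: \<rho>_def ext_metric_on_def)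
    show "\<rho> x y = 0 \<longleftrightarrow> x = y" if xy: "x \<in> topspace Y" "y \<in> topspace Y" for x y
    proof -
      have "\<rho> x y = 0 \<longleftrightarrow> min 1 (d x y) = 0"
        using \<rho>[OF xy] nonneg[of x y] by (metis ennreal_eq_0_iff order_antisym order_refl)
      also have "\<dots> \<longleftrightarrow> d x y = 0"
        by (auto simp: min_def)
      finally show ?thesis
        using ext xy by (auto simp: ext_metric_on_def)
    qed
    show "\<rho> x z \<le> \<rho> x y + \<rho> y z"
      if xyz: "x \<in> topspace Y" "y \<in> topspace Y" "z \<in> topspace Y" for x y z
    proof -
      have "d x z \<le> d x y + d y z"
        using ext xyz by (auto simp: ext_metric_on_def)
      then have "min 1 (d x z) \<le> min 1 (d x y) + min 1 (d y z)"
        by (auto simp: min_def add_increasing add_increasing2 intro: order_trans)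
      then have "ennreal (\<rho> x z) \<le> ennreal (\<rho> x y + \<rho> y z)"
        using \<rho> xyz nonneg by simp
      then show ?thesis
        using nonneg by (simp add: ennreal_le_iff del: ennreal_plus)
    qed
  qed
  interpret Metric_space "topspace Y" \<rho>
    by (rule metric)
  have "openin mtopology U" if "openin Y U" for U
  proof (rule generate_topology_on_coarsest)
    show "generate_topology_on {ext_ball (topspace Y) d x r | x r. x \<in> topspace Y \<and> 0 < r} U"
      using that unfolding gen .
    fix B assume "B \<in> {ext_ball (topspace Y) d x r | x r. x \<in> topspace Y \<and> 0 < r}"
    then obtain x r where x: "x \<in> topspace Y" "0 < r" and B: "B = ext_ball (topspace Y) d x r"
      by blast
    show "openin mtopology B"
      unfolding openin_mtopology
    proof (intro conjI allI impI)
      fix y assume "y \<in> B"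
      then have y: "y \<in> topspace Y" "d x y < ennreal r"
        by (auto simp: B ext_ball_def)
      then obtain t where t: "0 \<le> t" "d x y = ennreal t"
        by (metis ennreal_cases not_less_iff_gr_or_eq ennreal_less_top order_less_trans)
      with y x have "t < r"
        by (simp add: ennreal_less_iff)
      let ?s = "min 1 (r - t)"
      have "z \<in> B" if "z \<in> mball y ?s" for z
      proof -
        have z: "z \<in> topspace Y" "d y z < ennreal ?s"
          using that less[of y z ?s] y by auto
        have "d x z \<le> d x y + d y z"
          using ext x y z by (auto simp: ext_metric_on_def)
        also have "\<dots> < ennreal t + ennreal ?s"
          using z t by (simp add: ennreal_add_left_cancel_less)
        also have "\<dots> = ennreal (t + ?s)"
          using t \<open>t < r\<close> by (simp add: ennreal_plus)
        also have "\<dots> \<le> ennreal r"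
          by (intro ennreal_leI) auto
        finally show ?thesis
          using z by (simp add: B ext_ball_def)
      qed
      then show "\<exists>s>0. mball y s \<subseteq> B"
        using \<open>t < r\<close> by (intro exI[of _ ?s]) auto
    qed (auto simp: B ext_ball_def)
  qed (rule istopology_openin)
  moreover have "openin Y U" if U: "openin mtopology U" for U
  proof -
    have sub: "U \<subseteq> topspace Y"
      using openin_subset[OF U] by simp
    have "\<forall>x\<in>U. \<exists>r>0. mball x r \<subseteq> U"
      using U openin_mtopology by blast
    then obtain r where r: "\<And>x. x \<in> U \<Longrightarrow> 0 < r x \<and> mball x (r x) \<subseteq> U"
      by metis
    have "ext_ball (topspace Y) d x (min 1 (r x)) = mball x (min 1 (r x))" if "x \<in> U" for x
      using less[of x _ "min 1 (r x)"] that sub by (auto simp: ext_ball_def)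
    moreover have "openin Y (ext_ball (topspace Y) d x (min 1 (r x)))" if "x \<in> U" for x
      unfolding gen
    proof (rule generate_topology_on.Basis)
      have "x \<in> topspace Y" "0 < min 1 (r x)"
        using that sub r by auto
      then show "ext_ball (topspace Y) d x (min 1 (r x))
          \<in> {ext_ball (topspace Y) d x r | x r. x \<in> topspace Y \<and> 0 < r}"
        by blast
    qed
    ultimately have "openin Y (\<Union>x\<in>U. mball x (min 1 (r x)))"
      by (intro openin_Union) auto
    moreover have "U = (\<Union>x\<in>U. mball x (min 1 (r x)))"
      using r sub by fastforce
    ultimately show ?thesis
      by simp
  qed
  ultimately have "mtopology = Y"
    unfolding topology_eq by blast
  with metric show ?thesis
    by (rule that) (rule less)
qed

lemma openin_ext_ball:
  assumes "compatible_metric X d" "x \<in> topspace X" "0 < r"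
  shows "openin X (ext_ball (topspace X) d x r)"
proof -
  let ?B = "{ext_ball (topspace X) d x r | x r. x \<in> topspace X \<and> 0 < r}"
  have X: "X = topology_generated_by ?B"
    using assms(1) by (simp add: compatible_metric_def)
  have "ext_ball (topspace X) d x r \<in> ?B"
    using assms(2,3) by blast
  then have "openin (topology_generated_by ?B) (ext_ball (topspace X) d x r)"
    by (rule topology_generated_by_Basis)
  then show ?thesis
    unfolding X[symmetric] .
qed

lemma ext_ball_subset_openin:
  assumes "compatible_metric X d" and U: "openin X U" "x \<in> U"
  obtains r where "0 < r" "ext_ball (topspace X) d x r \<subseteq> U"
proof -
  obtain \<rho> where \<rho>: "Metric_space (topspace X) \<rho>" "Metric_space.mtopology (topspace X) \<rho> = X"
    and less: "\<And>x y c. \<lbrakk>x \<in> topspace X; y \<in> topspace X; c \<le> 1\<rbrakk> \<Longrightarrow> d x y < ennreal c \<longleftrightarrow> \<rho> x y < c"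
    using compatible_metric_truncate[OF assms(1)] by metis
  interpret Metric_space "topspace X" \<rho>
    by (rule \<rho>)
  have "openin mtopology U"
    unfolding \<rho>(2) by (rule U)
  then obtain r where r: "0 < r" "mball x r \<subseteq> U"
    using U(2) unfolding openin_mtopology by blast
  have "x \<in> topspace X"
    using U openin_subset by blast
  then have "ext_ball (topspace X) d x (min 1 r) \<subseteq> mball x r"
    using less[of x _ "min 1 r"] by (auto simp: ext_ball_def)
  then show ?thesis
    using r by (intro that[of "min 1 r"]) auto
qed

lemma center_in_ext_ball:
  assumes "compatible_metric X d" "x \<in> topspace X" "0 < r"
  shows "x \<in> ext_ball (topspace X) d x r"
proof -
  have "d x x = 0"
    using assms(1,2) unfolding compatible_metric_def ext_metric_on_def by blast
  then show ?thesis
    using assms by (simp add: ext_ball_def)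
qed

section \<open>Locally finite covers and metrics at infinity\<close>

lemma metrizable_separable_imp_second_countable:
  assumes "metrizable_space X" "separable_space X"
  shows "second_countable X"
proof -
  obtain M d where "Metric_space M d" and X: "X = Metric_space.mtopology M d"
    using assms(1) unfolding metrizable_space_def by blast
  interpret Metric_space M d
    by fact
  obtain C where C: "countable C" "C \<subseteq> M" "mtopology closure_of C = M"
    using assms(2) unfolding separable_space_def X by auto
  let ?B = "(\<lambda>(c, n). mball c (inverse (Suc n))) ` (C \<times> UNIV)"
  show ?thesis
    unfolding second_countable_def X
  proof (intro exI[of _ ?B] conjI allI impI)
    show "countable ?B"
      using C(1) by blast
    show "\<forall>V\<in>?B. openin mtopology V"
      by auto
    fix U x assume "openin mtopology U \<and> x \<in> U"
    then obtain r where r: "0 < r" "mball x r \<subseteq> U" and x: "x \<in> M"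
      unfolding openin_mtopology by blast
    obtain n where n: "inverse (Suc n) < r / 2"
      using reals_Archimedean[of "r / 2"] r by auto
    have "x \<in> mtopology closure_of C"
      using C x by simp
    then have "\<forall>e>0. \<exists>c\<in>C. c \<in> mball x e"
      unfolding metric_closure_of by blast
    moreover have "0 < inverse (real (Suc n))"
      by simp
    ultimately obtain c where c: "c \<in> C" "c \<in> mball x (inverse (Suc n))"
      by metis
    have "mball c (inverse (Suc n)) \<subseteq> mball x r"
    proof
      fix z assume "z \<in> mball c (inverse (Suc n))"
      then show "z \<in> mball x r"
        using c n triangle[of x c z] by auto
    qed
    moreover have "x \<in> mball c (inverse (Suc n))"
      using c by (auto simp: commute)
    ultimately show "\<exists>V\<in>?B. x \<in> V \<and> V \<subseteq> U"
      using r c by blast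
  qed
qed

definition locally_finite_family :: "'a topology \<Rightarrow> (nat \<Rightarrow> 'a set) \<Rightarrow> bool" where
  "locally_finite_family X U \<longleftrightarrow>
     (\<forall>x\<in>topspace X. \<exists>N. openin X N \<and> x \<in> N \<and> finite {n. U n \<inter> N \<noteq> {}})"

text \<open>
  From the \<open>n\<close>-th set of a countable open cover one keeps the points at distance less than
  \<open>1 / (n + 1)\<close> from the complement of each earlier set. A point of the \<open>k\<close>-th set has a ball inside
  that set, so it is kept only finitely often.
\<close>
lemma countable_cover_locally_finite_refinement:
  fixes W :: "nat \<Rightarrow> 'a set"
  assumes "metrizable_space X" and op: "\<And>n. openin X (W n)" and cover: "(\<Union>n. W n) = topspace X"
  obtains U where "\<And>n. openin X (U n)" "\<And>n. U n \<subseteq> W n" "(\<Union>n. U n) = topspace X"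
    "locally_finite_family X U"
proof -
  obtain M d where "Metric_space M d" and X: "X = Metric_space.mtopology M d"
    using assms(1) unfolding metrizable_space_def by blast
  interpret Metric_space M d
    by fact
  have W: "W n \<subseteq> M" for n
    using cover X by auto
  define U where
    "U n = W n \<inter> (\<Inter>i\<in>{..<n}. \<Union>y\<in>M - W i. mball y (inverse (Suc n)))" for n
  have opI: "openin X (\<Inter>i\<in>{..<n}. \<Union>y\<in>M - W i. mball y (inverse (Suc n)))" if "n \<noteq> 0" for n
    using that unfolding X by (intro openin_Inter openin_Union finite_imageI) auto
  have 1: "openin X (U n)" for n
  proof (cases "n = 0")
    case False
    then show ?thesis
      unfolding U_def using opI op by blast
  qed (simp add: U_def op)
  have 2: "U n \<subseteq> W n" for n
    by (auto simp: U_def)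
  have "x \<in> (\<Union>n. U n)" if "x \<in> topspace X" for x
  proof -
    have ex: "\<exists>n. x \<in> W n"
      using that cover by blast
    define k where "k = (LEAST n. x \<in> W n)"
    have "x \<in> W k"
      unfolding k_def using ex by (rule LeastI_ex)
    moreover have "x \<notin> W i" if "i < k" for i
      using that not_less_Least k_def by blast
    ultimately have "x \<in> U k"
      using W[of k] unfolding U_def by fastforce
    then show ?thesis
      by blast
  qed
  then have 3: "(\<Union>n. U n) = topspace X"
    using 2 cover by blast
  have "locally_finite_family X U"
    unfolding locally_finite_family_def
  proof
    fix x assume "x \<in> topspace X"
    then obtain k where k: "x \<in> W k"
      using cover by blast
    then obtain r where r: "0 < r" "mball x r \<subseteq> W k"
      using op[of k] unfolding X openin_mtopology by blast
    obtain m where m: "inverse (Suc m) < r / 2"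
      using reals_Archimedean[of "r / 2"] r by auto
    have x: "x \<in> M"
      using W k by blast
    have "n \<le> k + m" if meets: "U n \<inter> mball x (r / 2) \<noteq> {}" for n
    proof (rule ccontr)
      assume "\<not> n \<le> k + m"
      then have n: "k < n" "m \<le> n"
        by auto
      obtain z where z: "z \<in> U n" "z \<in> mball x (r / 2)"
        using meets by blast
      then obtain y where y: "y \<in> M" "y \<notin> W k" "z \<in> mball y (inverse (Suc n))"
        using n unfolding U_def by blast
      have "inverse (real (Suc n)) \<le> inverse (real (Suc m))"
        using n by (intro le_imp_inverse_le) auto
      moreover have "d x z < r / 2" "d y z < inverse (real (Suc n))" "d x y \<le> d x z + d z y"
        using y z triangle[of x z y] by auto
      ultimately have "d x y < r"
        using m commute[of y z] by linarith
      then show False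
        using r y x by auto
    qed
    then have "{n. U n \<inter> mball x (r / 2) \<noteq> {}} \<subseteq> {..k + m}"
      by blast
    then have "finite {n. U n \<inter> mball x (r / 2) \<noteq> {}}"
      using finite_subset by blast
    then show "\<exists>N. openin X N \<and> x \<in> N \<and> finite {n. U n \<inter> N \<noteq> {}}"
      using x r unfolding X by (intro exI[of _ "mball x (r / 2)"]) auto
  qed
  with 1 2 3 show ?thesis
    by (rule that)
qed

text \<open>
  The empty set is required to belong to the given cover so that the refinement can be indexed by
  the natural numbers even when \<open>X\<close> is empty.
\<close>
lemma relatively_compact_locally_finite_refinement:
  assumes X: "locally_compact_Polish X"
    and op: "\<And>C. C \<in> \<C> \<Longrightarrow> openin X C" and cover: "\<Union>\<C> = topspace X" and empty: "{} \<in> \<C>"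
  obtains U :: "nat \<Rightarrow> 'a set" and C :: "nat \<Rightarrow> 'a set"
  where "\<And>n. openin X (U n)" "\<And>n. C n \<in> \<C>" "\<And>n. compactin X (X closure_of U n)"
    "\<And>n. X closure_of U n \<subseteq> C n" "(\<Union>n. U n) = topspace X" "locally_finite_family X U"
proof -
  have metr: "metrizable_space X"
    using X completely_metrizable_imp_metrizable_space by (auto simp: locally_compact_Polish_def)
  then have haus: "Hausdorff_space X"
    by (rule metrizable_imp_Hausdorff_space)
  have base: "neighbourhood_base_of (\<lambda>K. compactin X K \<and> closedin X K) X"
    using X haus locally_compact_space_neighbourhood_base_closedin
    by (auto simp: locally_compact_Polish_def)
  define \<W> where "\<W> = {W. openin X W \<and> compactin X (X closure_of W) \<and> (\<exists>C\<in>\<C>. X closure_of W \<subseteq> C)}"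
  have "x \<in> \<Union>\<W>" if x: "x \<in> topspace X" for x
  proof -
    obtain C where C: "C \<in> \<C>" "x \<in> C"
      using x cover by blast
    then obtain W K where W: "openin X W" "x \<in> W" "W \<subseteq> K" "K \<subseteq> C" "compactin X K" "closedin X K"
      using base op unfolding neighbourhood_base_of by meson
    have cl: "X closure_of W \<subseteq> K"
      using W by (simp add: closure_of_minimal)
    then have "compactin X (X closure_of W)"
      using W closed_compactin closedin_closure_of by blast
    then show ?thesis
      using cl W C unfolding \<W>_def by blast
  qed
  then have cov: "\<Union>\<W> = topspace X"
    using openin_subset unfolding \<W>_def by blast
  have "Lindelof_space X"
    using X metr metrizable_separable_imp_second_countable second_countable_imp_Lindelof_space
    by (auto simp: locally_compact_Polish_def)
  moreover have "openin X W" if "W \<in> \<W>" for W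
    using that by (simp add: \<W>_def)
  ultimately obtain \<V> where \<V>: "countable \<V>" "\<V> \<subseteq> \<W>" "\<Union>\<V> = topspace X"
    using Lindelof_spaceD[of X \<W>] cov by metis
  define W where "W = from_nat_into (insert {} \<V>)"
  have range: "range W = insert {} \<V>"
    unfolding W_def using \<V>(1) by (intro range_from_nat_into) auto
  have mem: "W n \<in> \<W>" for n
  proof -
    have "{} \<in> \<W>"
      using empty by (auto simp: \<W>_def)
    moreover have "W n \<in> insert {} \<V>"
      unfolding range[symmetric] by (rule rangeI)
    ultimately show ?thesis
      using \<V>(2) by auto
  qed
  then have W: "openin X (W n)" "compactin X (X closure_of W n)" "\<exists>C\<in>\<C>. X closure_of W n \<subseteq> C" for n
    unfolding \<W>_def by simp_all
  have "(\<Union>n. W n) = topspace X"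
    using range \<V>(3) by simp
  with metr W(1) obtain U where U: "\<And>n. openin X (U n)" "\<And>n. U n \<subseteq> W n" "(\<Union>n. U n) = topspace X"
    "locally_finite_family X U"
    by (rule countable_cover_locally_finite_refinement) blast
  obtain C where C: "\<And>n. C n \<in> \<C>" "\<And>n. X closure_of W n \<subseteq> C n"
    using W(3) by metis
  have cl: "X closure_of U n \<subseteq> X closure_of W n" for n
    using U(2) by (rule closure_of_mono)
  then have "compactin X (X closure_of U n)" for n
    using closed_compactin[OF W(2)] closedin_closure_of by blast
  moreover have "X closure_of U n \<subseteq> C n" for n
    using cl C(2) by (rule order_trans)
  ultimately show ?thesis
    using that[of U C] U C(1) by simp
qed

lemma locally_finite_family_compactin:
  assumes "locally_finite_family X U" "compactin X K"
  shows "finite {n. U n \<inter> K \<noteq> {}}"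
proof -
  have "\<forall>x\<in>K. \<exists>N. openin X N \<and> x \<in> N \<and> finite {n. U n \<inter> N \<noteq> {}}"
    using assms compactin_subset_topspace unfolding locally_finite_family_def by blast
  then obtain N where N: "\<And>x. x \<in> K \<Longrightarrow> openin X (N x) \<and> x \<in> N x \<and> finite {n. U n \<inter> N x \<noteq> {}}"
    by metis
  have "\<exists>F. finite F \<and> F \<subseteq> N ` K \<and> K \<subseteq> \<Union>F"
    by (rule compactinD[OF assms(2)]) (use N in auto)
  then obtain F where F: "finite F" "F \<subseteq> N ` K" "K \<subseteq> \<Union>F"
    by blast
  have "{n. U n \<inter> K \<noteq> {}} \<subseteq> (\<Union>A\<in>F. {n. U n \<inter> A \<noteq> {}})"
    using F(3) by blast
  moreover have "finite (\<Union>A\<in>F. {n. U n \<inter> A \<noteq> {}})"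
    using F N by (intro finite_UN_I) auto
  ultimately show ?thesis
    by (rule finite_subset)
qed

text \<open>
  A neighbourhood meeting only finitely many members may be shrunk by removing the closures of those
  members that do not accumulate at the point.
\<close>
lemma locally_finite_family_neighbourhood:
  assumes "locally_finite_family X U" "x \<in> topspace X"
  obtains N where "openin X N" "x \<in> N" "finite {n. U n \<inter> N \<noteq> {}}"
    "\<And>n. U n \<inter> N \<noteq> {} \<Longrightarrow> x \<in> X closure_of U n"
proof -
  obtain N where N: "openin X N" "x \<in> N" "finite {n. U n \<inter> N \<noteq> {}}"
    using assms unfolding locally_finite_family_def by blast
  let ?F = "{n. U n \<inter> N \<noteq> {} \<and> x \<notin> X closure_of U n}"
  let ?N = "N - (\<Union>n\<in>?F. X closure_of U n)"
  have "finite ?F"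
    using N(3) by (rule rev_finite_subset) blast
  then have op: "openin X ?N"
    using N(1) by (intro openin_diff closedin_Union) auto
  have "{n. U n \<inter> ?N \<noteq> {}} \<subseteq> {n. U n \<inter> N \<noteq> {}}"
    by blast
  then have fin: "finite {n. U n \<inter> ?N \<noteq> {}}"
    using N(3) finite_subset by blast
  have cl: "x \<in> X closure_of U n" if "U n \<inter> ?N \<noteq> {}" for n
  proof (rule ccontr)
    assume "x \<notin> X closure_of U n"
    moreover obtain z where z: "z \<in> U n" "z \<in> ?N"
      using \<open>U n \<inter> ?N \<noteq> {}\<close> by blast
    ultimately have "z \<notin> X closure_of U n"
      by blast
    moreover have "z \<in> topspace X"
      using z(2) op openin_subset by blast
    ultimately show False
      using z(1) by (auto simp: in_closure_of)
  qed
  show ?thesis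
    using that[OF op _ fin cl] N(2) by blast
qed

text \<open>
  If \<open>w\<close> is positive and 1-Lipschitz for \<open>d\<close>, then the minimum of \<open>d x y\<close> and \<open>w x + w y\<close> is a metric
  with the topology of \<open>d\<close>, and the diameter of a set is at most twice the supremum of \<open>w\<close> on it.
  When \<open>w\<close> vanishes at infinity this is a metric of the one-point compactification, without the
  point at infinity. Here \<open>w x\<close> is the supremum of the radii \<open>r \<le> (1/2)^n\<close> for which the ball around \<open>x\<close>
  lies in \<open>U n\<close>: where \<open>w\<close> is not small, \<open>x\<close> lies in some \<open>U n\<close> with small \<open>n\<close>, and by compactness of
  its closure such a \<open>U n\<close> meets only finitely many members of the family.
\<close>
lemma metric_with_vanishing_diameters:
  assumes "metrizable_space X" and op: "\<And>n. openin X (U n)"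
    and cover: "(\<Union>n. U n) = topspace X" and cpt: "\<And>n. compactin X (X closure_of U n)"
    and lf: "locally_finite_family X U"
  obtains \<rho> where "Metric_space (topspace X) \<rho>" "Metric_space.mtopology (topspace X) \<rho> = X"
    "\<And>c. 0 < c \<Longrightarrow> finite {n. \<exists>x\<in>U n. \<exists>y\<in>U n. c \<le> \<rho> x y}"
proof -
  obtain M d where "Metric_space M d" and X: "X = Metric_space.mtopology M d"
    using assms(1) unfolding metrizable_space_def by blast
  interpret d: Metric_space M d
    by fact
  have M: "topspace X = M"
    by (simp add: X)
  (* The element 0 keeps the supremum meaningful at points without any admissible radius. *)
  define R where "R x = insert 0 {r. \<exists>n. 0 < r \<and> r \<le> (1/2) ^ n \<and> x \<in> M \<and> d.mball x r \<subseteq> U n}" for x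
  define w where "w x = Sup (R x)" for x
  have bdd: "bdd_above (R x)" for x
  proof (rule bdd_aboveI[of _ 1])
    fix r assume "r \<in> R x"
    then show "r \<le> 1"
      unfolding R_def using power_le_one[of "1/2::real"] by (auto intro: order_trans)
  qed
  have upper: "r \<le> w x" if "r \<in> R x" for r x
    unfolding w_def using that bdd by (rule cSup_upper)
  have nonneg: "0 \<le> w x" for x
    by (rule upper) (simp add: R_def)
  have pos: "0 < w x" if x: "x \<in> M" for x
  proof -
    obtain n where "x \<in> U n"
      using x cover M by blast
    then obtain r where r: "0 < r" "d.mball x r \<subseteq> U n"
      using op[of n] unfolding X d.openin_mtopology by blast
    then have "min r ((1/2) ^ n) \<in> R x"
      using x by (auto simp: R_def intro!: exI[of _ n])
    then show ?thesis
      using upper[of "min r ((1/2) ^ n)" x] r zero_less_power[of "1/2::real" n] by linarith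
  qed
  have lip: "w x \<le> w y + d x y" if "x \<in> M" "y \<in> M" for x y
    unfolding w_def[of x]
  proof (rule cSup_least)
    fix r assume r: "r \<in> R x"
    show "r \<le> w y + d x y"
    proof (cases "r \<le> d x y")
      case False
      then have "0 < r"
        using d.nonneg[of x y] by linarith
      then obtain n where n: "r \<le> (1/2) ^ n" "d.mball x r \<subseteq> U n"
        using r by (auto simp: R_def)
      have "d.mball y (r - d x y) \<subseteq> d.mball x r"
        using that d.triangle[of x y] by fastforce
      moreover have "r - d x y \<le> (1/2) ^ n"
        using n d.nonneg[of x y] by linarith
      ultimately have "r - d x y \<in> R y"
        using n that False by (auto simp: R_def intro!: exI[of _ n])
      then show ?thesis
        using upper by fastforce
    qed (use nonneg[of y] in linarith)
  qed (simp add: R_def)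
  define \<rho> where "\<rho> x y = min (d x y) (w x + w y)" for x y
  have metric: "Metric_space M \<rho>"
  proof
    show "0 \<le> \<rho> x y" for x y
      using nonneg[of x] nonneg[of y] by (simp add: \<rho>_def)
    show "\<rho> x y = \<rho> y x" for x y
      by (simp add: \<rho>_def d.commute add.commute)
    show "\<rho> x y = 0 \<longleftrightarrow> x = y" if "x \<in> M" "y \<in> M" for x y
      using pos[OF that(1)] pos[OF that(2)] d.zero[OF that] by (auto simp: \<rho>_def min_def)
    show "\<rho> x z \<le> \<rho> x y + \<rho> y z" if "x \<in> M" "y \<in> M" "z \<in> M" for x y z
      using d.triangle[OF that] lip[of x y] lip[of z y] that nonneg[of y] d.commute[of y z]
      by (auto simp: \<rho>_def min_def)
  qed
  interpret r: Metric_space M \<rho>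
    by (rule metric)
  have "openin r.mtopology A \<longleftrightarrow> openin d.mtopology A" for A
  proof -
    have "(\<exists>e>0. r.mball x e \<subseteq> A) \<longleftrightarrow> (\<exists>e>0. d.mball x e \<subseteq> A)" if x: "x \<in> M" for x
    proof
      assume "\<exists>e>0. r.mball x e \<subseteq> A"
      then obtain e where e: "e > 0" "r.mball x e \<subseteq> A"
        by blast
      moreover have "d.mball x e \<subseteq> r.mball x e"
        by (auto simp: \<rho>_def)
      ultimately show "\<exists>e>0. d.mball x e \<subseteq> A"
        by blast
    next
      assume "\<exists>e>0. d.mball x e \<subseteq> A"
      then obtain e where e: "e > 0" "d.mball x e \<subseteq> A"
        by blast
      have "r.mball x (min e (w x)) \<subseteq> d.mball x e"
      proof
        fix z assume "z \<in> r.mball x (min e (w x))"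
        then show "z \<in> d.mball x e"
          using nonneg[of z] by (auto simp: \<rho>_def min_less_iff_disj)
      qed
      then show "\<exists>e>0. r.mball x e \<subseteq> A"
        using e pos[OF x] by (intro exI[of _ "min e (w x)"]) auto
    qed
    then show ?thesis
      unfolding r.openin_mtopology d.openin_mtopology by blast
  qed
  then have top: "r.mtopology = X"
    unfolding X topology_eq by blast
  have "finite {n. \<exists>x\<in>U n. \<exists>y\<in>U n. c \<le> \<rho> x y}" if c: "0 < c" for c
  proof -
    obtain N where N: "(1/2) ^ N < c / 2"
      using real_arch_pow_inv[of "c / 2" "1/2"] c by auto
    have large: "\<exists>m<N. x \<in> U m" if "c / 2 \<le> w x" for x
    proof -
      have "(1/2) ^ N < Sup (R x)"
        using that N by (simp add: w_def)
      then obtain r where r: "r \<in> R x" "(1/2) ^ N < r"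
        using less_cSup_iff[OF _ bdd] by (auto simp: R_def)
      moreover have "r \<noteq> 0"
        using r zero_less_power[of "1/2::real" N] by linarith
      ultimately obtain m where m: "0 < r" "r \<le> (1/2) ^ m" "x \<in> M" "d.mball x r \<subseteq> U m"
        by (auto simp: R_def)
      then have "(1/2::real) ^ N < (1/2) ^ m"
        using r by linarith
      then have "m < N"
        by (simp add: power_strict_decreasing_iff)
      moreover have "x \<in> U m"
        using m by auto
      ultimately show ?thesis
        by blast
    qed
    have sub: "{n. \<exists>x\<in>U n. \<exists>y\<in>U n. c \<le> \<rho> x y} \<subseteq> (\<Union>m\<in>{..<N}. {n. U n \<inter> X closure_of U m \<noteq> {}})"
    proof
      fix n assume "n \<in> {n. \<exists>x\<in>U n. \<exists>y\<in>U n. c \<le> \<rho> x y}"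
      then obtain x y where xy: "x \<in> U n" "y \<in> U n" "c \<le> \<rho> x y"
        by blast
      then have "c \<le> w x + w y"
        by (simp add: \<rho>_def)
      then have "c / 2 \<le> w x \<or> c / 2 \<le> w y"
        by linarith
      then obtain z m where "z \<in> U n" "m < N" "z \<in> U m"
        using large xy by blast
      moreover have "U m \<subseteq> X closure_of U m"
        using op openin_subset closure_of_subset by metis
      ultimately show "n \<in> (\<Union>m\<in>{..<N}. {n. U n \<inter> X closure_of U m \<noteq> {}})"
        by blast
    qed
    show ?thesis
      by (rule finite_subset[OF sub]) (use locally_finite_family_compactin[OF lf cpt] in auto)
  qed
  then show ?thesis
    by (rule that[of \<rho>, unfolded M, OF metric top])
qed

text \<open>
  The images under \<open>f\<close> of small balls centred in \<open>K\<close> are an open cover of the compact set \<open>f(K)\<close>, and any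
  Lebesgue number of this cover serves as \<open>e\<close>.
\<close>
lemma Ph_inverse_uniformly_continuous_on_compact:
  assumes f: "f \<in> Ph X Y"
    and X: "Metric_space (topspace X) \<rho>" "Metric_space.mtopology (topspace X) \<rho> = X"
    and Y: "Metric_space (topspace Y) \<sigma>" "Metric_space.mtopology (topspace Y) \<sigma> = Y"
    and K: "compactin X K" "K \<subseteq> dom f" and c: "0 < c"
  obtains e where "0 < e"
    "\<And>x x' y y'. \<lbrakk>x \<in> K; f x = Some y; f x' = Some y'; \<sigma> y y' < e\<rbrakk> \<Longrightarrow> \<rho> x x' < c"
proof -
  interpret X: Metric_space "topspace X" \<rho>
    by (rule X)
  interpret Y: Metric_space "topspace Y" \<sigma>
    by (rule Y)
  have cpt: "compactin Y (pimage f K)"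
  proof -
    have "homeomorphic_map (subtopology X (dom f)) (subtopology Y (ran f)) (\<lambda>x. the (f x))"
      using f by (simp add: Ph_def)
    then have "continuous_map (subtopology X (dom f)) Y (\<lambda>x. the (f x))"
      using homeomorphic_imp_continuous_map continuous_map_into_fulltopology by blast
    moreover have "compactin (subtopology X (dom f)) K"
      using K by (simp add: compactin_subtopology)
    ultimately have "compactin Y ((\<lambda>x. the (f x)) ` K)"
      by (rule image_compactin[rotated])
    moreover have "(\<lambda>x. the (f x)) ` K = pimage f K"
      using K(2) by (force simp: pimage_def)
    ultimately show ?thesis
      by simp
  qed
  have sub: "K \<subseteq> topspace X"
    using K(1) by (rule compactin_subset_topspace)
  have "\<exists>e>0. \<forall>y\<in>pimage f K. \<exists>V\<in>(\<lambda>a. pimage f (X.mball a (c / 2))) ` K. Y.mball y e \<subseteq> V"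
  proof (rule Y.lebesgue_number)
    show "compactin Y.mtopology (pimage f K)"
      unfolding Y(2) by (rule cpt)
    show "pimage f K \<subseteq> \<Union> ((\<lambda>a. pimage f (X.mball a (c / 2))) ` K)"
    proof
      fix y assume "y \<in> pimage f K"
      then obtain x where x: "x \<in> K" "f x = Some y"
        by (auto simp: pimage_iff)
      then have "x \<in> X.mball x (c / 2)"
        using c sub by auto
      then have "y \<in> pimage f (X.mball x (c / 2))"
        using x(2) unfolding pimage_iff by blast
      then show "y \<in> \<Union> ((\<lambda>a. pimage f (X.mball a (c / 2))) ` K)"
        using x(1) by blast
    qed
    show "openin Y.mtopology V" if "V \<in> (\<lambda>a. pimage f (X.mball a (c / 2))) ` K" for V
      using that X.openin_mball Ph_openin_pimage[OF f] unfolding X(2) Y(2) by blast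
  qed
  then obtain e where e: "0 < e"
    "\<And>y. y \<in> pimage f K \<Longrightarrow> \<exists>a\<in>K. Y.mball y e \<subseteq> pimage f (X.mball a (c / 2))"
    by blast
  show ?thesis
  proof (rule that[OF e(1)])
    fix x x' y y' assume x: "x \<in> K" "f x = Some y" "f x' = Some y'" "\<sigma> y y' < e"
    have yM: "y \<in> topspace Y" "y' \<in> topspace Y"
      using Ph_SomeD[OF f] x by blast+
    obtain a where a: "Y.mball y e \<subseteq> pimage f (X.mball a (c / 2))"
      using e(2)[of y] x by (auto simp: pimage_def)
    have "y \<in> Y.mball y e" "y' \<in> Y.mball y e"
      using yM x e(1) by auto
    then have "y \<in> pimage f (X.mball a (c / 2))" "y' \<in> pimage f (X.mball a (c / 2))"
      using a by blast+
    then obtain z z' where "z \<in> X.mball a (c / 2)" "f z = Some y"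
      and "z' \<in> X.mball a (c / 2)" "f z' = Some y'"
      unfolding pimage_iff by blast
    then have "x \<in> X.mball a (c / 2)" "x' \<in> X.mball a (c / 2)"
      using Ph_eq[OF f x(2)] Ph_eq[OF f x(3)] by metis+
    then show "\<rho> x x' < c"
      using X.triangle[of x a x'] X.commute[of x a] by auto
  qed
qed

section \<open>Equivalences as a symmetric relation\<close>

text \<open>
  The properties of an equivalence that the proof uses, in a form that is symmetric under exchanging
  the two sides and passing to inverses. The conjugation clauses combine invariance of \<open>\<Phi>\<close> under both
  actions with the transition maps belonging to \<open>G\<close> and \<open>H\<close>. The empty map, which belongs to \<open>\<Phi>\<close> by
  gluing the empty cover, provides charts for a countable cover also when the spaces are empty.
\<close>
definition linked ::
  "'a topology \<Rightarrow> ('a \<rightharpoonup> 'a) set \<Rightarrow> 'b topology \<Rightarrow> ('b \<rightharpoonup> 'b) set \<Rightarrow> ('a \<rightharpoonup> 'b) set \<Rightarrow> bool" where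
  "linked X G Y H \<Phi> \<longleftrightarrow>
     \<Phi> \<subseteq> Ph X Y \<and> Map.empty \<in> \<Phi> \<and>
     (\<forall>\<phi>\<in>\<Phi>. \<forall>U. openin X U \<longrightarrow> \<phi> |` U \<in> \<Phi>) \<and>
     (\<Union>\<phi>\<in>\<Phi>. dom \<phi>) = topspace X \<and> (\<Union>\<phi>\<in>\<Phi>. ran \<phi>) = topspace Y \<and>
     (\<forall>\<phi>\<in>\<Phi>. \<forall>\<psi>\<in>\<Phi>. (\<forall>g\<in>G. \<psi> \<circ>\<^sub>m g \<circ>\<^sub>m pinv \<phi> \<in> H) \<and> (\<forall>h\<in>H. pinv \<psi> \<circ>\<^sub>m h \<circ>\<^sub>m \<phi> \<in> G))"

lemma linkedD:
  assumes "linked X G Y H \<Phi>"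
  shows "\<phi> \<in> \<Phi> \<Longrightarrow> \<phi> \<in> Ph X Y" "Map.empty \<in> \<Phi>" "\<phi> \<in> \<Phi> \<Longrightarrow> openin X U \<Longrightarrow> \<phi> |` U \<in> \<Phi>"
    "(\<Union>\<phi>\<in>\<Phi>. dom \<phi>) = topspace X" "(\<Union>\<phi>\<in>\<Phi>. ran \<phi>) = topspace Y"
    "\<phi> \<in> \<Phi> \<Longrightarrow> \<psi> \<in> \<Phi> \<Longrightarrow> g \<in> G \<Longrightarrow> \<psi> \<circ>\<^sub>m g \<circ>\<^sub>m pinv \<phi> \<in> H"
    "\<phi> \<in> \<Phi> \<Longrightarrow> \<psi> \<in> \<Phi> \<Longrightarrow> h \<in> H \<Longrightarrow> pinv \<psi> \<circ>\<^sub>m h \<circ>\<^sub>m \<phi> \<in> G"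
  using assms by (simp_all add: linked_def subset_iff)

lemma pseudogroup_equivalence_imp_linked:
  assumes G: "pseudogroup X G" and H: "pseudogroup Y H"
    and eqv: "pseudogroup_equivalence X G Y H \<Phi>"
  shows "linked X G Y H \<Phi>"
proof -
  have Ph: "\<Phi> \<subseteq> Ph X Y" and dom: "(\<Union>\<phi>\<in>\<Phi>. dom \<phi>) = topspace X"
    and ran: "(\<Union>\<phi>\<in>\<Phi>. ran \<phi>) = topspace Y"
    and restr: "\<And>\<phi> U. \<phi> \<in> \<Phi> \<Longrightarrow> openin X U \<Longrightarrow> U \<subseteq> dom \<phi> \<Longrightarrow> \<phi> |` U \<in> \<Phi>"
    and act: "\<And>g h \<phi>. g \<in> G \<Longrightarrow> h \<in> H \<Longrightarrow> \<phi> \<in> \<Phi> \<Longrightarrow> h \<circ>\<^sub>m \<phi> \<circ>\<^sub>m g \<in> \<Phi>"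
    and cmp: "\<And>\<phi> \<psi>. \<phi> \<in> \<Phi> \<Longrightarrow> \<psi> \<in> \<Phi> \<Longrightarrow> pinv \<psi> \<circ>\<^sub>m \<phi> \<in> G \<and> \<psi> \<circ>\<^sub>m pinv \<phi> \<in> H"
    using eqv by (simp_all add: pseudogroup_equivalence_def)
  have glue: "\<forall>\<phi>\<in>Ph X Y. \<forall>\<U>. (\<forall>U\<in>\<U>. openin X U) \<and> \<Union>\<U> = dom \<phi> \<and> (\<forall>U\<in>\<U>. \<phi> |` U \<in> \<Phi>)
      \<longrightarrow> \<phi> \<in> \<Phi>"
    using eqv unfolding pseudogroup_equivalence_def by (elim conjE)
  have empty: "Map.empty \<in> \<Phi>"
  proof -
    have "Map.empty \<in> Ph X Y"
      by (simp add: Ph_iff pimage_def pinv_def)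
    then show ?thesis
      using glue[rule_format, of Map.empty "{}"] by simp
  qed
  have restr': "\<phi> |` U \<in> \<Phi>" if "\<phi> \<in> \<Phi>" "openin X U" for \<phi> U
  proof -
    have "openin X (U \<inter> dom \<phi>)"
      using that Ph by (blast intro: Ph_openin_dom)
    then have "\<phi> |` (U \<inter> dom \<phi>) \<in> \<Phi>"
      using restr that by blast
    moreover have "\<phi> |` (U \<inter> dom \<phi>) = \<phi> |` U"
      by (rule pmap_eqI) (auto simp: restrict_eq_Some_iff)
    ultimately show ?thesis
      by simp
  qed
  have fwd: "\<psi> \<circ>\<^sub>m g \<circ>\<^sub>m pinv \<phi> \<in> H" if "\<phi> \<in> \<Phi>" "\<psi> \<in> \<Phi>" "g \<in> G" for \<phi> \<psi> g
  proof -
    have "pid Y \<circ>\<^sub>m \<psi> \<circ>\<^sub>m g \<in> \<Phi>"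
      using act pseudogroupD(2)[OF H] that by blast
    moreover have "pid Y \<circ>\<^sub>m \<psi> \<circ>\<^sub>m g = \<psi> \<circ>\<^sub>m g"
      using Ph_SomeD[of \<psi> X Y] Ph that by (intro pmap_eqI) (auto simp: pmap_simps)
    ultimately show ?thesis
      using cmp that by metis
  qed
  have bwd: "pinv \<psi> \<circ>\<^sub>m h \<circ>\<^sub>m \<phi> \<in> G" if "\<phi> \<in> \<Phi>" "\<psi> \<in> \<Phi>" "h \<in> H" for \<phi> \<psi> h
  proof -
    have "h \<circ>\<^sub>m \<phi> \<circ>\<^sub>m pid X \<in> \<Phi>"
      using act pseudogroupD(2)[OF G] that by blast
    then have "pinv \<psi> \<circ>\<^sub>m (h \<circ>\<^sub>m \<phi> \<circ>\<^sub>m pid X) \<in> G"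
      using cmp that by blast
    moreover have "pinv \<psi> \<circ>\<^sub>m (h \<circ>\<^sub>m \<phi> \<circ>\<^sub>m pid X) = pinv \<psi> \<circ>\<^sub>m h \<circ>\<^sub>m \<phi>"
      using Ph_SomeD[of \<phi> X Y] Ph that by (intro pmap_eqI) (auto simp: pmap_simps)
    ultimately show ?thesis
      by simp
  qed
  show ?thesis
    unfolding linked_def using Ph empty restr' dom ran fwd bwd by simp
qed

lemma linked_sym:
  assumes L: "linked X G Y H \<Phi>"
  shows "linked Y H X G (pinv ` \<Phi>)"
proof -
  have Ph: "\<phi> \<in> Ph X Y" if "\<phi> \<in> \<Phi>" for \<phi>
    using linkedD(1)[OF L that] .
  have dr: "dom (pinv \<phi>) = ran \<phi>" "ran (pinv \<phi>) = dom \<phi>" if "\<phi> \<in> \<Phi>" for \<phi>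
    using Ph_pinv_iff[OF Ph[OF that]] by (auto simp: dom_def ran_def)
  have "pinv \<phi> |` V \<in> pinv ` \<Phi>" if \<phi>: "\<phi> \<in> \<Phi>" and V: "openin Y V" for \<phi> V
  proof -
    let ?U = "pimage (pinv \<phi>) V"
    have U: "openin X ?U"
      using Ph_openin_preimage[OF Ph[OF \<phi>] V] .
    have "pinv \<phi> |` V = pinv (\<phi> |` ?U)"
      by (rule pmap_eqI) (auto simp: Ph_pinv_iff[OF Ph_restrict[OF Ph[OF \<phi>] U]]
          Ph_pinv_iff[OF Ph[OF \<phi>]] pmap_simps)
    then show ?thesis
      using linkedD(3)[OF L \<phi> U] by blast
  qed
  moreover have "Map.empty \<in> pinv ` \<Phi>"
    using linkedD(2)[OF L] by (auto simp: pinv_def image_iff intro!: bexI[of _ Map.empty])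
  moreover have "pinv ` \<Phi> \<subseteq> Ph Y X"
    using Ph Ph_pinv by blast
  moreover have "(\<Union>\<phi>\<in>pinv ` \<Phi>. dom \<phi>) = topspace Y" "(\<Union>\<phi>\<in>pinv ` \<Phi>. ran \<phi>) = topspace X"
    using dr linkedD(4,5)[OF L] by auto
  moreover have "pinv (pinv \<phi>) = \<phi>" if "\<phi> \<in> \<Phi>" for \<phi>
    using pinv_pinv[OF Ph[OF that]] .
  ultimately show ?thesis
    unfolding linked_def using linkedD(6,7)[OF L] by simp
qed

section \<open>Transitivity and periodic orbits\<close>

lemma topologically_transitive_linked:
  assumes L: "linked X G Y H \<Phi>" and trans: "topologically_transitive X G"
  shows "topologically_transitive Y H"
  unfolding topologically_transitive_def
proof (intro allI impI)
  fix U V assume UV: "openin Y U \<and> U \<noteq> {} \<and> openin Y V \<and> V \<noteq> {}"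
  have pull: "\<exists>\<phi>\<in>\<Phi>. openin X (pimage (pinv \<phi>) W) \<and> pimage (pinv \<phi>) W \<noteq> {}"
    if W: "openin Y W" "W \<noteq> {}" for W
  proof -
    obtain y where y: "y \<in> W" "y \<in> topspace Y"
      using W openin_subset by blast
    then obtain \<phi> where \<phi>: "\<phi> \<in> \<Phi>" "y \<in> ran \<phi>"
      using linkedD(5)[OF L] by blast
    then obtain x where "\<phi> x = Some y"
      by (auto simp: ran_def)
    then have "x \<in> pimage (pinv \<phi>) W"
      using y Ph_pinv_iff[OF linkedD(1)[OF L \<phi>(1)]] by (auto simp: pimage_iff)
    then show ?thesis
      using \<phi>(1) Ph_openin_preimage[OF linkedD(1)[OF L \<phi>(1)] W(1)] by blast
  qed
  obtain \<phi> where \<phi>: "\<phi> \<in> \<Phi>" "openin X (pimage (pinv \<phi>) U)" "pimage (pinv \<phi>) U \<noteq> {}"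
    using pull[of U] UV by blast
  obtain \<psi> where \<psi>: "\<psi> \<in> \<Phi>" "openin X (pimage (pinv \<psi>) V)" "pimage (pinv \<psi>) V \<noteq> {}"
    using pull[of V] UV by blast
  obtain g where g: "g \<in> G" "pimage g (pimage (pinv \<phi>) U) \<inter> pimage (pinv \<psi>) V \<noteq> {}"
    using trans \<phi> \<psi> unfolding topologically_transitive_def by blast
  then obtain u x x' v where "u \<in> U" "pinv \<phi> u = Some x" "g x = Some x'" "v \<in> V" "pinv \<psi> v = Some x'"
    by (auto simp: pimage_iff)
  moreover have "\<psi> x' = Some v"
    using calculation(5) by (simp add: Ph_pinv_iff[OF linkedD(1)[OF L \<psi>(1)]])
  ultimately have "v \<in> pimage (\<psi> \<circ>\<^sub>m g \<circ>\<^sub>m pinv \<phi>) U \<inter> V"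
    by (auto simp: pimage_iff map_comp_Some_iff)
  then show "\<exists>h\<in>H. pimage h U \<inter> V \<noteq> {}"
    using linkedD(6)[OF L \<phi>(1) \<psi>(1) g(1)] by blast
qed

lemma orbit_subset:
  assumes G: "pseudogroup X G" and y: "y \<in> orbit G x"
  shows "orbit G y \<subseteq> orbit G x"
proof
  fix z assume "z \<in> orbit G y"
  then obtain g h where "g \<in> G" "g x = Some y" "h \<in> G" "h y = Some z"
    using y by (auto simp: orbit_def)
  then have "h \<circ>\<^sub>m g \<in> G" "(h \<circ>\<^sub>m g) x = Some z"
    using pseudogroupD(4)[OF G] by (auto simp: map_comp_Some_iff)
  then show "z \<in> orbit G x"
    by (auto simp: orbit_def)
qed

lemma orbit_prestrict:
  assumes G: "pseudogroup X G" and U: "openin X U" and x: "x \<in> U"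
  shows "orbit (prestrict G U) x = orbit G x \<inter> U"
proof
  show "orbit (prestrict G U) x \<subseteq> orbit G x \<inter> U"
    by (auto simp: orbit_def prestrict_def ran_def)
  show "orbit G x \<inter> U \<subseteq> orbit (prestrict G U) x"
  proof
    fix y assume "y \<in> orbit G x \<inter> U"
    then obtain g where g: "g \<in> G" "g x = Some y" and y: "y \<in> U"
      by (auto simp: orbit_def)
    have Ph: "g \<in> Ph X X"
      using g pseudogroupD(1)[OF G] by blast
    let ?V = "U \<inter> pimage (pinv g) U"
    have "openin X ?V"
      using U Ph_openin_preimage[OF Ph U] by blast
    then have "g |` ?V \<in> G"
      using pseudogroup_restrict[OF G g(1)] by blast
    moreover have "dom (g |` ?V) \<subseteq> U" "ran (g |` ?V) \<subseteq> U"
      by (auto simp: ran_def restrict_eq_Some_iff pimage_iff Ph_pinv_iff[OF Ph])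
    moreover have "(g |` ?V) x = Some y"
      using g x y by (auto simp: restrict_eq_Some_iff pimage_iff Ph_pinv_iff[OF Ph])
    ultimately show "y \<in> orbit (prestrict G U) x"
      unfolding orbit_def prestrict_def by blast
  qed
qed

text \<open>
  By \<open>orbit_prestrict\<close> the orbits of the restricted pseudogroup are traces of orbits of \<open>G\<close>, so the union
  of the finite ones consists of the points of \<open>U\<close> whose own trace is finite.
\<close>
lemma density_of_periodic_orbits_iff:
  assumes G: "pseudogroup X G"
  shows "density_of_periodic_orbits X G \<longleftrightarrow>
    (\<exists>U. openin X U \<and> (\<forall>x\<in>topspace X. orbit G x \<inter> U \<noteq> {}) \<and>
       (\<forall>W. openin X W \<and> W \<subseteq> U \<and> W \<noteq> {} \<longrightarrow> (\<exists>x\<in>W. finite (orbit G x \<inter> U))))"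
proof -
  have key: "subtopology X U closure_of
      (\<Union>{orbit (prestrict G U) x | x. x \<in> U \<and> finite (orbit (prestrict G U) x)}) = U \<longleftrightarrow>
    (\<forall>W. openin X W \<and> W \<subseteq> U \<and> W \<noteq> {} \<longrightarrow> (\<exists>x\<in>W. finite (orbit G x \<inter> U)))"
    if U: "openin X U" for U
  proof -
    have sub: "U \<subseteq> topspace X"
      using U by (rule openin_subset)
    then have top: "topspace (subtopology X U) = U"
      by auto
    have refl: "x \<in> orbit G x" if "x \<in> topspace X" for x
      using that pseudogroupD(2)[OF G] by (auto simp: orbit_def pid_eq_Some_iff intro!: bexI[of _ "pid X"])
    have "\<Union>{orbit (prestrict G U) x | x. x \<in> U \<and> finite (orbit (prestrict G U) x)}
        = {x \<in> U. finite (orbit G x \<inter> U)}" (is "?P = ?Q")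
    proof
      show "?P \<subseteq> ?Q"
      proof
        fix y assume "y \<in> ?P"
        then obtain x where x: "x \<in> U" "finite (orbit G x \<inter> U)" "y \<in> orbit G x \<inter> U"
          using orbit_prestrict[OF G U] by auto
        then have "orbit G y \<inter> U \<subseteq> orbit G x \<inter> U"
          using orbit_subset[OF G] by blast
        then show "y \<in> ?Q"
          using x finite_subset by blast
      qed
      show "?Q \<subseteq> ?P"
      proof
        fix x assume "x \<in> ?Q"
        then have "x \<in> U" "finite (orbit (prestrict G U) x)" "x \<in> orbit (prestrict G U) x"
          using orbit_prestrict[OF G U, of x] refl[of x] sub by auto
        then show "x \<in> ?P"
          by blast
      qed
    qed
    then have "subtopology X U closure_of ?P = U \<longleftrightarrow>
        (\<forall>W. openin (subtopology X U) W \<and> W \<noteq> {} \<longrightarrow> ?Q \<inter> W \<noteq> {})"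
      using dense_intersects_open[of "subtopology X U" ?Q] top by simp
    also have "\<dots> \<longleftrightarrow> (\<forall>W. openin X W \<and> W \<subseteq> U \<and> W \<noteq> {} \<longrightarrow> ?Q \<inter> W \<noteq> {})"
      by (simp add: openin_open_subtopology[OF U] conj_assoc)
    also have "\<dots> \<longleftrightarrow> (\<forall>W. openin X W \<and> W \<subseteq> U \<and> W \<noteq> {} \<longrightarrow> (\<exists>x\<in>W. finite (orbit G x \<inter> U)))"
    proof -
      have "?Q \<inter> W \<noteq> {} \<longleftrightarrow> (\<exists>x\<in>W. finite (orbit G x \<inter> U))" if "W \<subseteq> U" for W
        using that by blast
      then show ?thesis
        by (simp cong: conj_cong imp_cong)
    qed
    finally show ?thesis .
  qed
  show ?thesis
    unfolding density_of_periodic_orbits_def by (simp only: key cong: conj_cong)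
qed

lemma linked_locally_finite_cover:
  assumes X: "locally_compact_Polish X" and L: "linked X G Y H \<Phi>"
  obtains U :: "nat \<Rightarrow> 'a set" and \<phi> :: "nat \<Rightarrow> 'a \<rightharpoonup> 'b"
  where "\<And>n. \<phi> n \<in> \<Phi>" "\<And>n. openin X (U n)" "\<And>n. compactin X (X closure_of U n)"
    "\<And>n. X closure_of U n \<subseteq> dom (\<phi> n)" "(\<Union>n. U n) = topspace X" "locally_finite_family X U"
proof -
  have op: "\<And>C. C \<in> dom ` \<Phi> \<Longrightarrow> openin X C"
    using linkedD(1)[OF L] Ph_openin_dom by blast
  have cov: "\<Union>(dom ` \<Phi>) = topspace X" and emp: "{} \<in> dom ` \<Phi>"
    using linkedD(2,4)[OF L] by (auto intro!: image_eqI[of _ _ Map.empty])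
  show ?thesis
  proof (rule relatively_compact_locally_finite_refinement[OF X op cov emp])
    fix U C :: "nat \<Rightarrow> 'a set"
    assume U: "\<And>n. openin X (U n)" and C: "\<And>n. C n \<in> dom ` \<Phi>"
      and cpt: "\<And>n. compactin X (X closure_of U n)" and sub: "\<And>n. X closure_of U n \<subseteq> C n"
      and U': "(\<Union>n. U n) = topspace X" "locally_finite_family X U"
    have "\<forall>n. \<exists>\<phi>\<in>\<Phi>. C n = dom \<phi>"
      using C by blast
    then obtain \<phi> where \<phi>: "\<And>n. \<phi> n \<in> \<Phi>" "\<And>n. C n = dom (\<phi> n)"
      by metis
    have "X closure_of U n \<subseteq> dom (\<phi> n)" for n
      using sub[of n] \<phi>(2)[of n] by simp
    with \<phi>(1) U cpt show thesis
      using U' by (rule that)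
  qed
qed

text \<open>
  Only finitely many sets of a locally finite cover contain a given point, so an orbit of \<open>H\<close> meets
  the union of the transported pieces of \<open>U\<close> in a finite set when the corresponding orbit of \<open>G\<close>
  meets \<open>U\<close> in a finite set.
\<close>
lemma density_of_periodic_orbits_linked:
  assumes X: "locally_compact_Polish X" and G: "pseudogroup X G" and H: "pseudogroup Y H"
    and L: "linked X G Y H \<Phi>" and dens: "density_of_periodic_orbits X G"
  shows "density_of_periodic_orbits Y H"
proof -
  obtain U where U: "openin X U" and meets: "\<forall>x\<in>topspace X. orbit G x \<inter> U \<noteq> {}"
    and dense: "\<forall>W. openin X W \<and> W \<subseteq> U \<and> W \<noteq> {} \<longrightarrow> (\<exists>x\<in>W. finite (orbit G x \<inter> U))"
    using dens unfolding density_of_periodic_orbits_iff[OF G] by (elim exE conjE)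
  obtain A :: "nat \<Rightarrow> 'a set" and \<phi> :: "nat \<Rightarrow> 'a \<rightharpoonup> 'b"
    where \<phi>: "\<And>n. \<phi> n \<in> \<Phi>" and A: "\<And>n. openin X (A n)" "\<And>n. X closure_of A n \<subseteq> dom (\<phi> n)"
      "(\<Union>n. A n) = topspace X" "locally_finite_family X A"
    using linked_locally_finite_cover[OF X L] by metis
  have Ph: "\<phi> n \<in> Ph X Y" for n
    using linkedD(1)[OF L \<phi>] .
  have A_dom: "A n \<subseteq> dom (\<phi> n)" for n
    using closure_of_subset[OF openin_subset[OF A(1)]] A(2) by (rule order_trans)
  define V where "V = (\<Union>n. pimage (\<phi> n) (A n \<inter> U))"
  have "openin Y V"
    unfolding V_def using A(1) U Ph_openin_pimage[OF Ph] by (intro openin_Union) blast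
  moreover have "orbit H y \<inter> V \<noteq> {}" if y: "y \<in> topspace Y" for y
  proof -
    obtain \<psi> x where \<psi>: "\<psi> \<in> \<Phi>" "\<psi> x = Some y"
      using y unfolding linkedD(5)[OF L, symmetric] by (auto simp: ran_def)
    have Ph\<psi>: "\<psi> \<in> Ph X Y"
      using linkedD(1)[OF L \<psi>(1)] .
    then have "x \<in> topspace X"
      using Ph_SomeD \<psi>(2) by metis
    then obtain g u where g: "g \<in> G" "g x = Some u" "u \<in> U"
      using meets by (fastforce simp: orbit_def)
    have "u \<in> topspace X"
      using U g(3) openin_subset by blast
    then obtain n where n: "u \<in> A n"
      using A(3) by blast
    then obtain v where v: "\<phi> n u = Some v"
      using A_dom by blast
    have "(\<phi> n \<circ>\<^sub>m g \<circ>\<^sub>m pinv \<psi>) y = Some v"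
      using v g(2) \<psi>(2) by (simp add: map_comp_Some_iff Ph_pinv_iff[OF Ph\<psi>])
    then have "v \<in> orbit H y"
      using linkedD(6)[OF L \<psi>(1) \<phi> g(1)] unfolding orbit_def by blast
    moreover have "v \<in> V"
      using v n g(3) by (auto simp: V_def pimage_iff)
    ultimately show ?thesis
      by blast
  qed
  moreover have "\<exists>y\<in>W. finite (orbit H y \<inter> V)" if W: "openin Y W" "W \<subseteq> V" "W \<noteq> {}" for W
  proof -
    obtain y0 n x0 where "y0 \<in> W" "x0 \<in> A n \<inter> U" "\<phi> n x0 = Some y0"
      using W(2,3) by (fastforce simp: V_def pimage_iff)
    then have ne: "U \<inter> pimage (pinv (\<phi> n)) W \<noteq> {}"
      by (auto simp: pimage_iff Ph_pinv_iff[OF Ph])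
    have "openin X (U \<inter> pimage (pinv (\<phi> n)) W)"
      using U Ph_openin_preimage[OF Ph W(1)] by blast
    then obtain x where x: "x \<in> U \<inter> pimage (pinv (\<phi> n)) W" "finite (orbit G x \<inter> U)"
      using dense ne by blast
    then obtain y where y: "y \<in> W" "\<phi> n x = Some y"
      by (auto simp: pimage_iff Ph_pinv_iff[OF Ph])
    have fin: "finite {m. u \<in> A m}" if u: "u \<in> topspace X" for u
    proof -
      obtain N where "u \<in> N" "finite {m. A m \<inter> N \<noteq> {}}"
        using A(4) u unfolding locally_finite_family_def by blast
      then show ?thesis
        by (elim rev_finite_subset) blast
    qed
    have "orbit H y \<inter> V \<subseteq> (\<Union>u\<in>orbit G x \<inter> U. (\<lambda>m. the (\<phi> m u)) ` {m. u \<in> A m})"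
    proof
      fix z assume z: "z \<in> orbit H y \<inter> V"
      then obtain h where h: "h \<in> H" "h y = Some z"
        by (auto simp: orbit_def)
      obtain m u where u: "u \<in> A m" "u \<in> U" "\<phi> m u = Some z"
        using z by (auto simp: V_def pimage_iff)
      have "(pinv (\<phi> m) \<circ>\<^sub>m h \<circ>\<^sub>m \<phi> n) x = Some u"
        using u(3) h(2) y(2) by (simp add: map_comp_Some_iff Ph_pinv_iff[OF Ph])
      then have "u \<in> orbit G x"
        using linkedD(7)[OF L \<phi> \<phi> h(1)] unfolding orbit_def by blast
      then show "z \<in> (\<Union>u\<in>orbit G x \<inter> U. (\<lambda>m. the (\<phi> m u)) ` {m. u \<in> A m})"
        using u by force
    qed
    moreover have "finite (\<Union>u\<in>orbit G x \<inter> U. (\<lambda>m. the (\<phi> m u)) ` {m. u \<in> A m})"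
      using x(2) fin U openin_subset by (intro finite_UN_I finite_imageI) blast+
    ultimately show ?thesis
      using y(1) finite_subset by blast
  qed
  ultimately show ?thesis
    unfolding density_of_periodic_orbits_iff[OF H] by blast
qed

section \<open>Stable points\<close>

text \<open>
  Equicontinuity at a single scale \<open>c\<close>. The radius may depend on \<open>x\<close>, which is what negating
  sensitivity yields and what lets continuity of a chart at a single point carry stability over.
\<close>
definition stable_point ::
  "('a \<rightharpoonup> 'a) set \<Rightarrow> ('a \<Rightarrow> 'a \<Rightarrow> ennreal) \<Rightarrow> real \<Rightarrow> 'a \<Rightarrow> bool" where
  "stable_point S d c x \<longleftrightarrow>
     (\<exists>r>0. \<forall>s\<in>S. \<forall>y u v. s x = Some u \<and> s y = Some v \<and> d x y < ennreal r \<longrightarrow> d u v < ennreal c)"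

lemma not_sensitive_iff:
  "\<not> sensitive X G \<longleftrightarrow>
     (\<exists>d S. compatible_metric X d \<and> pseudostargroup X S \<and> generates X S G \<and>
        (\<forall>c>0. \<exists>x\<in>topspace X. stable_point S d c x))"
proof -
  have inner: "\<not> (\<exists>s\<in>S. \<exists>y. x \<in> dom s \<and> y \<in> dom s \<and> d x y < ennreal r \<and>
              ennreal c \<le> d (the (s x)) (the (s y))) \<longleftrightarrow>
      (\<forall>s\<in>S. \<forall>y u v. s x = Some u \<and> s y = Some v \<and> d x y < ennreal r \<longrightarrow> d u v < ennreal c)"
    (is "\<not> ?L \<longleftrightarrow> ?R") for S :: "('a \<rightharpoonup> 'a) set" and d c r x
  proof
    assume L: "\<not> ?L"
    show ?R
    proof (intro ballI allI impI, rule ccontr)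
      fix s y u v assume s: "s \<in> S" "s x = Some u \<and> s y = Some v \<and> d x y < ennreal r"
        and "\<not> d u v < ennreal c"
      then have "x \<in> dom s \<and> y \<in> dom s \<and> d x y < ennreal r \<and> ennreal c \<le> d (the (s x)) (the (s y))"
        by (auto simp: not_less)
      with L s(1) show False
        by blast
    qed
  next
    assume R: ?R
    show "\<not> ?L"
    proof clarify
      fix s y u v assume "s \<in> S" "d x y < ennreal r" "s x = Some u" "s y = Some v"
        and c: "ennreal c \<le> d (the (s x)) (the (s y))"
      then have "d u v < ennreal c" "ennreal c \<le> d u v"
        using R by auto
      then show False
        by (simp add: not_le[symmetric])
    qed
  qed
  have neg: "(\<not> (\<forall>d S. A d S \<longrightarrow> (\<exists>c::real. 0 < c \<and> (\<forall>x\<in>T. \<forall>r::real. 0 < r \<longrightarrow> P d S c x r)))) \<longleftrightarrow>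
      (\<exists>d S. A d S \<and> (\<forall>c>0. \<exists>x\<in>T. \<exists>r>0. \<not> P d S c x r))"
    for A :: "('a \<Rightarrow> 'a \<Rightarrow> ennreal) \<Rightarrow> ('a \<rightharpoonup> 'a) set \<Rightarrow> bool" and T :: "'a set" and P
    by blast
  show ?thesis
    unfolding sensitive_def neg inner stable_point_def by (simp only: conj_assoc)
qed

lemma equicontinuous_point_iff:
  assumes "star X S \<subseteq> Ph X X"
  shows "equicontinuous_point X S d x \<longleftrightarrow> (\<forall>c>0. stable_point (star X S) d c x)"
proof -
  have "(\<forall>s\<in>star X S. \<forall>y\<in>topspace X. x \<in> dom s \<and> y \<in> dom s \<and> d x y < ennreal r \<longrightarrow>
          d (the (s x)) (the (s y)) < ennreal c) \<longleftrightarrow>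
      (\<forall>s\<in>star X S. \<forall>y u v. s x = Some u \<and> s y = Some v \<and> d x y < ennreal r \<longrightarrow> d u v < ennreal c)"
    (is "?L \<longleftrightarrow> ?R") for r c
  proof
    assume L: ?L
    show ?R
    proof (intro ballI allI impI)
      fix s y u v assume s: "s \<in> star X S" "s x = Some u \<and> s y = Some v \<and> d x y < ennreal r"
      then have "y \<in> topspace X"
        using assms Ph_SomeD[of s X X y v] by blast
      then show "d u v < ennreal c"
        using L[rule_format, of s y] s by auto
    qed
  qed auto
  then show ?thesis
    unfolding equicontinuous_point_def stable_point_def by simp
qed

lemma almost_equicontinuous_iff:
  assumes G: "pseudogroup X G"
  shows "almost_equicontinuous X G \<longleftrightarrow>
    (\<exists>d S. compatible_metric X d \<and> pseudostargroup X S \<and> generates X S G \<and>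
       X closure_of {x \<in> topspace X. \<forall>c>0. stable_point S d c x} = topspace X)"
    (is "_ \<longleftrightarrow> ?R")
proof
  assume "almost_equicontinuous X G"
  then obtain S d where S: "generates X S G" and d: "compatible_metric X d"
    and dense: "X closure_of {x \<in> topspace X. equicontinuous_point X S d x} = topspace X"
    unfolding almost_equicontinuous_def by (elim exE conjE)
  have "S \<subseteq> G"
    using S by (simp add: generates_def)
  note star = pseudostargroup_star[OF G this]
  have "star X S \<subseteq> Ph X X"
    using star(2) pseudogroupD(1)[OF G] by (rule order_trans)
  then show ?R
    using d star(1) generates_star[OF G S] dense
    by (intro exI[of _ d] exI[of _ "star X S"]) (simp add: equicontinuous_point_iff)
next
  assume ?R
  then obtain d S where d: "compatible_metric X d" and S: "pseudostargroup X S" "generates X S G"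
    and dense: "X closure_of {x \<in> topspace X. \<forall>c>0. stable_point S d c x} = topspace X"
    by (elim exE conjE)
  have "equicontinuous_point X S d x \<longleftrightarrow> (\<forall>c>0. stable_point S d c x)" for x
    using equicontinuous_point_iff[of X S d x] pseudostargroupD(1)[OF S(1)]
    by (simp add: star_idem[OF S(1)])
  then show "almost_equicontinuous X G"
    unfolding almost_equicontinuous_def using d S(2) dense
    by (intro exI[of _ S] exI[of _ d]) simp
qed

text \<open>
  If \<open>s\<close> sends \<open>x\<close> to \<open>z\<close>, then any map \<open>t\<close> of \<open>S\<close> near \<open>z\<close> is tested by \<open>t \<circ>\<^sub>m s\<close> near \<open>x\<close>. This moves a stable
  point of \<open>Y\<close> into the image of a chart.
\<close>
lemma stable_point_orbit:
  assumes d: "compatible_metric X d" and S: "pseudostargroup X S"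
    and x: "stable_point S d c x" and s: "s \<in> S" "s x = Some z"
  shows "stable_point S d c z"
proof -
  have Ph: "s \<in> Ph X X"
    using pseudostargroupD(1)[OF S] s(1) by blast
  have top: "x \<in> topspace X" "z \<in> topspace X"
    using Ph_SomeD[OF Ph s(2)] by auto
  obtain r where r: "0 < r"
    and stable: "\<And>t y u v. \<lbrakk>t \<in> S; t x = Some u; t y = Some v; d x y < ennreal r\<rbrakk> \<Longrightarrow> d u v < ennreal c"
    using x unfolding stable_point_def by blast
  let ?B = "pimage s (ext_ball (topspace X) d x r)"
  have "openin X ?B"
    using Ph_openin_pimage[OF Ph openin_ext_ball[OF d top(1) r]] .
  moreover have "z \<in> ?B"
    using center_in_ext_ball[OF d top(1) r] s(2) by (auto simp: pimage_iff)
  ultimately obtain e where e: "0 < e" "ext_ball (topspace X) d z e \<subseteq> ?B"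
    using ext_ball_subset_openin[OF d] by metis
  have "d u v < ennreal c"
    if t: "t \<in> S" "t z = Some u" "t y = Some v" "d z y < ennreal e" for t y u v
  proof -
    have "t \<in> Ph X X"
      using pseudostargroupD(1)[OF S] t(1) by blast
    then have "y \<in> ?B"
      using e(2) t Ph_SomeD[of t X X y v] by (auto simp: ext_ball_def)
    then obtain y' where y': "s y' = Some y" "d x y' < ennreal r"
      by (auto simp: pimage_iff ext_ball_def)
    show ?thesis
    proof (rule stable)
      show "t \<circ>\<^sub>m s \<in> S"
        using pseudostargroupD(4)[OF S s(1) t(1)] .
    qed (use t s y' in auto)
  qed
  then show ?thesis
    unfolding stable_point_def using e(1) by blast
qed

section \<open>Transferring metrics and generators along an equivalence\<close>

lemma conjugate_pinv:
  assumes "\<phi> \<in> Ph X Y" "\<psi> \<in> Ph X Y" "g \<in> Ph X X"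
  shows "\<phi> \<circ>\<^sub>m pinv g \<circ>\<^sub>m pinv \<psi> = pinv (\<psi> \<circ>\<^sub>m g \<circ>\<^sub>m pinv \<phi>)"
proof (rule pmap_eqI)
  have "\<psi> \<circ>\<^sub>m g \<circ>\<^sub>m pinv \<phi> \<in> Ph Y Y"
    using assms by (intro Ph_comp Ph_pinv)
  then show "(\<phi> \<circ>\<^sub>m pinv g \<circ>\<^sub>m pinv \<psi>) v = Some u \<longleftrightarrow> pinv (\<psi> \<circ>\<^sub>m g \<circ>\<^sub>m pinv \<phi>) v = Some u" for u v
    using assms by (auto simp: map_comp_Some_iff Ph_pinv_iff)
qed

text \<open>
  Quantifying over all pairs of charts, and confining domain and image to single charts, makes this
  set closed under composition: a composite is read in a chart that contains all intermediate
  points, and each factor belongs to \<open>S\<close> when read in that chart.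
\<close>
definition chart_maps ::
  "('a \<rightharpoonup> 'a) set \<Rightarrow> ('b \<rightharpoonup> 'b) set \<Rightarrow> ('i \<Rightarrow> 'a \<rightharpoonup> 'b) \<Rightarrow> ('a \<rightharpoonup> 'a) set" where
  "chart_maps G S \<psi> = {g \<in> G. (\<exists>i. dom g \<subseteq> dom (\<psi> i)) \<and> (\<exists>j. ran g \<subseteq> dom (\<psi> j)) \<and>
     (\<forall>i j. \<psi> j \<circ>\<^sub>m g \<circ>\<^sub>m pinv (\<psi> i) \<in> S)}"

text \<open>
  The identity of \<open>X\<close> itself need not fit into one chart, so its restrictions have to be added.
\<close>
lemma pseudostargroup_chart_maps:
  assumes G: "pseudogroup X G" and S: "pseudostargroup Y S" and Ph: "\<And>i. \<psi> i \<in> Ph X Y"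
  shows "pseudostargroup X (chart_maps G S \<psi> \<union> {pid X |` W | W. openin X W})"
    (is "pseudostargroup X (?T \<union> ?I)")
proof -
  have GPh: "g \<in> Ph X X" if "g \<in> G" for g
    using pseudogroupD(1)[OF G] that by blast
  have TPh: "g \<in> Ph X X" if "g \<in> ?T" for g
    using GPh that by (simp add: chart_maps_def)
  have restr: "g |` W \<in> ?T" if g: "g \<in> ?T" and W: "openin X W" for g W
  proof -
    have "\<psi> j \<circ>\<^sub>m (g |` W) \<circ>\<^sub>m pinv (\<psi> i) = (\<psi> j \<circ>\<^sub>m g \<circ>\<^sub>m pinv (\<psi> i)) |` pimage (\<psi> i) W" for i j
    proof (rule pmap_eqI)
      have "x \<in> W" if "\<psi> i x = Some y" "\<psi> i x' = Some y" "x' \<in> W" for x x' y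
        using Ph_eq[OF Ph that(1,2)] that(3) by simp
      then show "(\<psi> j \<circ>\<^sub>m (g |` W) \<circ>\<^sub>m pinv (\<psi> i)) u = Some v \<longleftrightarrow>
          ((\<psi> j \<circ>\<^sub>m g \<circ>\<^sub>m pinv (\<psi> i)) |` pimage (\<psi> i) W) u = Some v" for u v
        by (auto simp: pmap_simps Ph_pinv_iff[OF Ph])
    qed
    moreover have "(\<psi> j \<circ>\<^sub>m g \<circ>\<^sub>m pinv (\<psi> i)) |` pimage (\<psi> i) W \<in> S" for i j
      using g pseudostargroup_restrict[OF S _ Ph_openin_pimage[OF Ph W]] by (simp add: chart_maps_def)
    moreover have "g |` W \<in> G"
      using pseudogroup_restrict[OF G _ W] g by (simp add: chart_maps_def)
    moreover have "dom (g |` W) \<subseteq> dom g" "ran (g |` W) \<subseteq> ran g"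
      by (auto simp: ran_def restrict_eq_Some_iff)
    ultimately show ?thesis
      using g unfolding chart_maps_def by (simp, meson order_trans le_infI1)
  qed
  have inv: "pinv g \<in> ?T" if g: "g \<in> ?T" for g
  proof -
    have "dom (pinv g) = ran g" "ran (pinv g) = dom g"
      using Ph_pinv_iff[OF TPh[OF g]] by (auto simp: dom_def ran_def)
    moreover have "\<psi> j \<circ>\<^sub>m pinv g \<circ>\<^sub>m pinv (\<psi> i) \<in> S" for i j
      unfolding conjugate_pinv[OF Ph Ph TPh[OF g]]
      using g pseudostargroupD(3)[OF S] by (simp add: chart_maps_def)
    ultimately show ?thesis
      using g pseudogroupD(3)[OF G] by (simp add: chart_maps_def)
  qed
  have comp: "h \<circ>\<^sub>m g \<in> ?T" if g: "g \<in> ?T" and h: "h \<in> ?T" for g h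
  proof -
    obtain k where k: "ran g \<subseteq> dom (\<psi> k)"
      using g by (auto simp: chart_maps_def)
    have "\<psi> j \<circ>\<^sub>m (h \<circ>\<^sub>m g) \<circ>\<^sub>m pinv (\<psi> i) =
        (\<psi> j \<circ>\<^sub>m h \<circ>\<^sub>m pinv (\<psi> k)) \<circ>\<^sub>m (\<psi> k \<circ>\<^sub>m g \<circ>\<^sub>m pinv (\<psi> i))" for i j
    proof (rule pmap_eqI)
      have "\<exists>w. \<psi> k y = Some w" if "g x = Some y" for x y
        using k ranI[of g, OF that] by auto
      moreover have "y = y'" if "\<psi> k y = Some w" "\<psi> k y' = Some w" for y y' w
        using Ph_eq[OF Ph that(2,1)] .
      ultimately show "(\<psi> j \<circ>\<^sub>m (h \<circ>\<^sub>m g) \<circ>\<^sub>m pinv (\<psi> i)) u = Some v \<longleftrightarrow>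
          ((\<psi> j \<circ>\<^sub>m h \<circ>\<^sub>m pinv (\<psi> k)) \<circ>\<^sub>m (\<psi> k \<circ>\<^sub>m g \<circ>\<^sub>m pinv (\<psi> i))) u = Some v" for u v
        unfolding map_comp_Some_iff Ph_pinv_iff[OF Ph] by (metis (no_types, lifting))
    qed
    then have "\<psi> j \<circ>\<^sub>m (h \<circ>\<^sub>m g) \<circ>\<^sub>m pinv (\<psi> i) \<in> S" for i j
      using g h pseudostargroupD(4)[OF S] by (simp add: chart_maps_def)
    moreover have "h \<circ>\<^sub>m g \<in> G"
      using g h pseudogroupD(4)[OF G] by (simp add: chart_maps_def)
    moreover have "dom (h \<circ>\<^sub>m g) \<subseteq> dom g" "ran (h \<circ>\<^sub>m g) \<subseteq> ran h"
      by (auto simp: ran_def map_comp_Some_iff)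
    ultimately show ?thesis
      using g h unfolding chart_maps_def by (simp, meson order_trans)
  qed
  have comp_id: "g \<circ>\<^sub>m (pid X |` W) = g |` W" "(pid X |` W) \<circ>\<^sub>m g = g |` pimage (pinv g) W"
    if "g \<in> Ph X X" for g W
    using Ph_SomeD[OF that] by (auto intro!: pmap_eqI simp: pmap_simps Ph_pinv_iff[OF that])
  have id: "pid X |` W \<in> Ph X X" "pinv (pid X |` W) = pid X |` W" if W: "openin X W" for W
  proof -
    show Ph: "pid X |` W \<in> Ph X X"
      by (rule Ph_restrict[OF Ph_pid W])
    show "pinv (pid X |` W) = pid X |` W"
      by (rule pmap_eqI) (auto simp: Ph_pinv_iff[OF Ph] pmap_simps)
  qed
  have id_restr: "(pid X |` W) |` W' \<in> ?I" if "openin X W" "openin X W'" for W W'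
    using openin_Int[OF that] by auto
  show ?thesis
    unfolding pseudostargroup_def
  proof (intro conjI ballI allI impI)
    show "?T \<union> ?I \<subseteq> Ph X X"
      using TPh id(1) by blast
    have "pid X |` topspace X = pid X"
      by (rule pmap_eqI) (auto simp: pmap_simps)
    then show "pid X \<in> ?T \<union> ?I"
      by (intro UnI2) (auto intro!: exI[of _ "topspace X"])
    show "pinv f \<in> ?T \<union> ?I" if f: "f \<in> ?T \<union> ?I" for f
      using f
    proof
      assume "f \<in> ?I"
      then show ?thesis
        using id(2) by auto
    qed (use inv in blast)
    show "f |` W \<in> ?T \<union> ?I" if f: "f \<in> ?T \<union> ?I" and W: "openin X W \<and> W \<subseteq> dom f" for f W
      using f
    proof
      assume "f \<in> ?I"
      then show ?thesis
        using id_restr W by blast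
    qed (use restr W in blast)
    show "g \<circ>\<^sub>m f \<in> ?T \<union> ?I" if f: "f \<in> ?T \<union> ?I" and g: "g \<in> ?T \<union> ?I" for f g
      using g
    proof
      assume g: "g \<in> ?T"
      show ?thesis
        using f
      proof
        assume "f \<in> ?I"
        then show ?thesis
          using comp_id(1)[OF TPh[OF g]] restr[OF g] by auto
      qed (use comp g in blast)
    next
      assume "g \<in> ?I"
      then obtain W where W: "openin X W" "g = pid X |` W"
        by blast
      have fPh: "f \<in> Ph X X"
        using f TPh id(1) by blast
      then have "g \<circ>\<^sub>m f = f |` pimage (pinv f) W" and op: "openin X (pimage (pinv f) W)"
        using comp_id(2) W Ph_openin_preimage by auto
      moreover have "f |` pimage (pinv f) W \<in> ?T \<union> ?I"
        using f
      proof
        assume "f \<in> ?I"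
        then show ?thesis
          using id_restr op by blast
      qed (use restr op in blast)
      ultimately show ?thesis
        by simp
    qed
  qed
qed

text \<open>
  Near a point only finitely many charts matter, and for each pair of them the transported map lies
  in the generated pseudogroup, hence locally in \<open>S\<close>. The closures of the pieces have to lie in
  the domains of the unrestricted charts, because a piece can come arbitrarily close to a point
  without containing it.
\<close>
lemma locally_in_chart_maps:
  fixes U :: "nat \<Rightarrow> 'a set"
  assumes G: "pseudogroup X G" and H: "pseudogroup Y H" and L: "linked X G Y H \<Phi>"
    and S: "pseudostargroup Y S" and gen: "generates Y S H"
    and \<phi>: "\<And>n. \<phi> n \<in> \<Phi>" and U: "\<And>n. openin X (U n)" "\<And>n. X closure_of U n \<subseteq> dom (\<phi> n)"
      "(\<Union>n. U n) = topspace X" "locally_finite_family X U"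
    and g: "g \<in> G"
  shows "locally_in X (chart_maps G S (\<lambda>n. \<phi> n |` U n)) g"
  unfolding locally_in_def
proof
  fix x assume "x \<in> dom g"
  then obtain x' where x': "g x = Some x'"
    by blast
  have gPh: "g \<in> Ph X X"
    using pseudogroupD(1)[OF G] g by blast
  have top: "x \<in> topspace X" "x' \<in> topspace X"
    using Ph_SomeD[OF gPh x'] by auto
  have Ph: "\<phi> n \<in> Ph X Y" for n
    using linkedD(1)[OF L \<phi>] .
  have \<psi>Ph: "\<phi> n |` U n \<in> Ph X Y" for n
    using Ph_restrict[OF Ph U(1)] .
  have U_dom: "U n \<subseteq> dom (\<phi> n)" for n
    using closure_of_subset[OF openin_subset[OF U(1)]] U(2) by (rule order_trans)
  obtain N where N: "openin X N" "x \<in> N" "finite {n. U n \<inter> N \<noteq> {}}"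
    "\<And>n. U n \<inter> N \<noteq> {} \<Longrightarrow> x \<in> X closure_of U n"
    using locally_finite_family_neighbourhood[OF U(4) top(1)] by metis
  obtain N' where N': "openin X N'" "x' \<in> N'" "finite {n. U n \<inter> N' \<noteq> {}}"
    "\<And>n. U n \<inter> N' \<noteq> {} \<Longrightarrow> x' \<in> X closure_of U n"
    using locally_finite_family_neighbourhood[OF U(4) top(2)] by metis
  obtain i0 where i0: "x \<in> U i0"
    using U(3) top(1) by blast
  obtain j0 where j0: "x' \<in> U j0"
    using U(3) top(2) by blast
  let ?P = "{n. U n \<inter> N \<noteq> {}} \<times> {n. U n \<inter> N' \<noteq> {}}"
  have "\<exists>O'. openin X O' \<and> x \<in> O' \<and> (\<forall>A. openin X A \<and> A \<subseteq> O' \<longrightarrow>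
      (\<phi> j |` U j) \<circ>\<^sub>m (g |` A) \<circ>\<^sub>m pinv (\<phi> i |` U i) \<in> S)"
    if ij: "U i \<inter> N \<noteq> {}" "U j \<inter> N' \<noteq> {}" for i j
  proof -
    obtain y where y: "\<phi> i x = Some y"
      using N(4)[OF ij(1)] U(2)[of i] by blast
    obtain y' where y': "\<phi> j x' = Some y'"
      using N'(4)[OF ij(2)] U(2)[of j] by blast
    let ?h = "\<phi> j \<circ>\<^sub>m g \<circ>\<^sub>m pinv (\<phi> i)"
    have "?h \<in> H"
      using linkedD(6)[OF L \<phi> \<phi> g] .
    then have "locally_in Y S ?h"
      using gen generates_iff_locally_in[OF H S] by blast
    moreover have "y \<in> dom ?h"
      using x' y y' by (auto simp: dom_def map_comp_Some_iff Ph_pinv_iff[OF Ph])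
    ultimately obtain V where V: "openin Y V" "y \<in> V" "?h |` V \<in> S"
      by (rule locally_inE)
    let ?O = "pimage (pinv (\<phi> i)) V"
    have "(\<phi> j |` U j) \<circ>\<^sub>m (g |` A) \<circ>\<^sub>m pinv (\<phi> i |` U i) \<in> S" if A: "openin X A" "A \<subseteq> ?O" for A
    proof -
      let ?A = "A \<inter> U i \<inter> pimage (pinv g) (U j)"
      have "openin X ?A"
        using A(1) U(1) Ph_openin_preimage[OF gPh] by blast
      then have "(?h |` V) |` pimage (\<phi> i) ?A \<in> S"
        using pseudostargroup_restrict[OF S V(3)] Ph_openin_pimage[OF Ph] by blast
      moreover have "(?h |` V) |` pimage (\<phi> i) ?A = (\<phi> j |` U j) \<circ>\<^sub>m (g |` A) \<circ>\<^sub>m pinv (\<phi> i |` U i)"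
      proof (rule pmap_eqI)
        fix u v
        show "((?h |` V) |` pimage (\<phi> i) ?A) u = Some v \<longleftrightarrow>
            ((\<phi> j |` U j) \<circ>\<^sub>m (g |` A) \<circ>\<^sub>m pinv (\<phi> i |` U i)) u = Some v" (is "?l \<longleftrightarrow> ?r")
        proof
          assume ?l
          then obtain a b z where a: "\<phi> i a = Some u" "g a = Some b" "\<phi> j b = Some v"
            and z: "z \<in> ?A" "\<phi> i z = Some u"
            by (auto simp: pmap_simps Ph_pinv_iff[OF Ph])
          then have "z = a"
            using Ph_eq[OF Ph] by blast
          then show ?r
            using a z(1) by (auto simp: pmap_simps Ph_pinv_iff[OF \<psi>Ph] Ph_pinv_iff[OF gPh])
        next
          assume ?r
          then obtain a b where a: "a \<in> U i" "\<phi> i a = Some u" "a \<in> A" "g a = Some b" "b \<in> U j" "\<phi> j b = Some v"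
            by (auto simp: pmap_simps Ph_pinv_iff[OF \<psi>Ph])
          moreover have "u \<in> V"
            using a A(2) by (auto simp: pimage_iff Ph_pinv_iff[OF Ph])
          ultimately show ?l
            by (auto simp: pmap_simps Ph_pinv_iff[OF Ph] Ph_pinv_iff[OF gPh])
        qed
      qed
      ultimately show ?thesis
        by simp
    qed
    moreover have "openin X ?O" "x \<in> ?O"
      using Ph_openin_preimage[OF Ph V(1)] V(2) y by (auto simp: pimage_iff Ph_pinv_iff[OF Ph])
    ultimately show ?thesis
      by blast
  qed
  then have "\<forall>p\<in>?P. \<exists>O'. openin X O' \<and> x \<in> O' \<and> (\<forall>A. openin X A \<and> A \<subseteq> O' \<longrightarrow>
      (\<phi> (snd p) |` U (snd p)) \<circ>\<^sub>m (g |` A) \<circ>\<^sub>m pinv (\<phi> (fst p) |` U (fst p)) \<in> S)"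
    by auto
  from bchoice[OF this] obtain B where B': "\<forall>p\<in>?P. openin X (B p) \<and> x \<in> B p \<and>
      (\<forall>A. openin X A \<and> A \<subseteq> B p \<longrightarrow>
        (\<phi> (snd p) |` U (snd p)) \<circ>\<^sub>m (g |` A) \<circ>\<^sub>m pinv (\<phi> (fst p) |` U (fst p)) \<in> S)"
    by (elim exE)
  have B: "openin X (B p)" "x \<in> B p" if "p \<in> ?P" for p
    using bspec[OF B' that] by simp_all
  have BA: "(\<phi> (snd p) |` U (snd p)) \<circ>\<^sub>m (g |` A) \<circ>\<^sub>m pinv (\<phi> (fst p) |` U (fst p)) \<in> S"
    if "p \<in> ?P" "openin X A" "A \<subseteq> B p" for p A
    using bspec[OF B' that(1)] that(2,3) by simp
  let ?M = "N \<inter> pimage (pinv g) N' \<inter> U i0 \<inter> pimage (pinv g) (U j0)"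
  (* The first part keeps domain and image inside one piece each and makes every pair of
     charts outside ?P transport the restriction to the empty map. *)
  let ?A = "?M \<inter> \<Inter> (B ` ?P)"
  have "openin X ?M"
    by (intro openin_Int N(1) N'(1) U(1) Ph_openin_preimage[OF gPh])
  moreover have "finite (B ` ?P)"
    using N(3) N'(3) by (intro finite_imageI finite_cartesian_product)
  ultimately have A: "openin X ?A"
    using B(1) by (intro openin_Int_Inter) (auto simp del: mem_Sigma_iff)
  have x: "x \<in> ?A"
    using N(2) N'(2) i0 j0 x' B(2) by (auto simp: pimage_iff Ph_pinv_iff[OF gPh])
  have "(\<phi> j |` U j) \<circ>\<^sub>m (g |` ?A) \<circ>\<^sub>m pinv (\<phi> i |` U i) \<in> S" for i j
  proof (cases "(i, j) \<in> ?P")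
    case True
    then have "?A \<subseteq> B (i, j)"
      by blast
    then show ?thesis
      using BA[OF True A] by simp
  next
    case False
    then have "(\<phi> j |` U j) \<circ>\<^sub>m (g |` ?A) \<circ>\<^sub>m pinv (\<phi> i |` U i) = Map.empty"
      by (intro pmap_eqI) (auto simp: pmap_simps Ph_pinv_iff[OF \<psi>Ph] Ph_pinv_iff[OF gPh])
    then show ?thesis
      using pseudostargroup_empty[OF S] by simp
  qed
  moreover have "g |` ?A \<in> G"
    using pseudogroup_restrict[OF G g A] .
  moreover have "dom (g |` ?A) \<subseteq> dom (\<phi> i0 |` U i0)" "ran (g |` ?A) \<subseteq> dom (\<phi> j0 |` U j0)"
    using U_dom[of i0] U_dom[of j0] by (auto simp: ran_def pmap_simps Ph_pinv_iff[OF gPh])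
  ultimately have "g |` ?A \<in> chart_maps G S (\<lambda>n. \<phi> n |` U n)"
    unfolding chart_maps_def by blast
  then show "\<exists>U'. openin X U' \<and> x \<in> U' \<and> g |` U' \<in> chart_maps G S (\<lambda>n. \<phi> n |` U n)"
    using A x by blast
qed

text \<open>
  The scale \<open>c'\<close> must serve all charts at once. Pieces of diameter less than \<open>c\<close> satisfy the estimate
  for every \<open>c'\<close>, and the finitely many others are treated by uniform continuity of their inverse
  charts on compact closures.
\<close>
lemma metric_controlled_by_charts:
  fixes U :: "nat \<Rightarrow> 'a set"
  assumes X: "metrizable_space X" and d': "compatible_metric Y d'"
    and Ph: "\<And>n. \<phi> n \<in> Ph X Y"
    and U: "\<And>n. openin X (U n)" "\<And>n. compactin X (X closure_of U n)"
      "\<And>n. X closure_of U n \<subseteq> dom (\<phi> n)" "(\<Union>n. U n) = topspace X" "locally_finite_family X U"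
  obtains d where "compatible_metric X d"
    "\<And>c. 0 < c \<Longrightarrow> \<exists>c'>0. \<forall>n. \<forall>x\<in>U n. \<forall>y\<in>U n.
       d' (the (\<phi> n x)) (the (\<phi> n y)) < ennreal c' \<longrightarrow> d x y < ennreal c"
proof -
  obtain \<rho> where \<rho>: "Metric_space (topspace X) \<rho>" "Metric_space.mtopology (topspace X) \<rho> = X"
    and fin: "\<And>c. 0 < c \<Longrightarrow> finite {n. \<exists>x\<in>U n. \<exists>y\<in>U n. c \<le> \<rho> x y}"
    by (rule metric_with_vanishing_diameters[OF X U(1,4,2,5)], rule that) blast+
  interpret Metric_space "topspace X" \<rho>
    by (rule \<rho>)
  obtain \<sigma> where \<sigma>: "Metric_space (topspace Y) \<sigma>" "Metric_space.mtopology (topspace Y) \<sigma> = Y"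
    and less: "\<And>x y c. \<lbrakk>x \<in> topspace Y; y \<in> topspace Y; c \<le> 1\<rbrakk> \<Longrightarrow> d' x y < ennreal c \<longleftrightarrow> \<sigma> x y < c"
    by (rule compatible_metric_truncate[OF d'], rule that) blast+
  have cl: "U n \<subseteq> X closure_of U n" for n
    using closure_of_subset[OF openin_subset[OF U(1)]] .
  show ?thesis
  proof (rule that[of "\<lambda>x y. ennreal (\<rho> x y)"])
    show "compatible_metric X (\<lambda>x y. ennreal (\<rho> x y))"
      using compatible_metric_of_Metric_space[OF \<rho>] .
    fix c :: real assume c: "0 < c"
    let ?F = "{n. \<exists>x\<in>U n. \<exists>y\<in>U n. c \<le> \<rho> x y}"
    have "\<exists>e>0. \<forall>x\<in>U n. \<forall>y\<in>U n. \<sigma> (the (\<phi> n x)) (the (\<phi> n y)) < e \<longrightarrow> \<rho> x y < c" for n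
    proof -
      obtain e where e: "0 < e" "\<And>x x' y y'. \<lbrakk>x \<in> X closure_of U n; \<phi> n x = Some y; \<phi> n x' = Some y';
          \<sigma> y y' < e\<rbrakk> \<Longrightarrow> \<rho> x x' < c"
        by (rule Ph_inverse_uniformly_continuous_on_compact[OF Ph \<rho> \<sigma> U(2,3) c], rule that) blast+
      have "\<rho> x y < c" if "x \<in> U n" "y \<in> U n" "\<sigma> (the (\<phi> n x)) (the (\<phi> n y)) < e" for x y
      proof (rule e(2))
        show "\<phi> n x = Some (the (\<phi> n x))" "\<phi> n y = Some (the (\<phi> n y))"
          using that(1,2) cl[of n] U(3)[of n] by (auto simp: dom_def subset_iff)
      qed (use that cl in auto)
      then show ?thesis
        using e(1) by blast
    qed
    then obtain e where e: "\<And>n. 0 < e n"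
      "\<And>n x y. \<lbrakk>x \<in> U n; y \<in> U n; \<sigma> (the (\<phi> n x)) (the (\<phi> n y)) < e n\<rbrakk> \<Longrightarrow> \<rho> x y < c"
      by metis
    (* Only distances below 1 agree with those of the truncated metric, whence the 1. *)
    let ?c' = "Min (insert 1 (e ` ?F))"
    have pos: "0 < ?c'" and le: "?c' \<le> 1" "\<And>n. n \<in> ?F \<Longrightarrow> ?c' \<le> e n"
      using fin[OF c] e(1) by (auto intro: Min_le)
    have "ennreal (\<rho> x y) < ennreal c"
      if xy: "x \<in> U n" "y \<in> U n" and d: "d' (the (\<phi> n x)) (the (\<phi> n y)) < ennreal ?c'" for n x y
    proof (cases "n \<in> ?F")
      case False
      then have "\<rho> x y < c"
        using xy by force
      then show ?thesis
        by (simp add: ennreal_less_iff)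
    next
      case True
      have "\<phi> n x = Some (the (\<phi> n x))" "\<phi> n y = Some (the (\<phi> n y))"
        using xy cl[of n] U(3)[of n] by (auto simp: dom_def subset_iff)
      then have "the (\<phi> n x) \<in> topspace Y" "the (\<phi> n y) \<in> topspace Y"
        using Ph_SomeD[OF Ph] by blast+
      then have "\<sigma> (the (\<phi> n x)) (the (\<phi> n y)) < e n"
        using d less[OF _ _ le(1)] le(2)[OF True] by fastforce
      then show ?thesis
        using e(2)[OF xy] by (simp add: ennreal_less_iff)
    qed
    then show "\<exists>c'>0. \<forall>n. \<forall>x\<in>U n. \<forall>y\<in>U n.
       d' (the (\<phi> n x)) (the (\<phi> n y)) < ennreal c' \<longrightarrow> ennreal (\<rho> x y) < ennreal c"
      using pos by blast
  qed
qed

text \<open>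
  A map \<open>s\<close> of \<open>S\<close> defined at \<open>x\<close> is compared with \<open>\<psi> j \<circ>\<^sub>m s \<circ>\<^sub>m pinv (\<psi> i)\<close>, where \<open>\<psi> i\<close> is the given chart at
  \<open>x\<close> and \<open>\<psi> j\<close> a chart containing the image of \<open>s\<close>. Near \<open>x\<close> continuity of \<open>\<psi> i\<close> is enough; at the other
  end the image point is arbitrary, so the uniform control of \<open>d\<close> by the charts is needed.
\<close>
lemma stable_points_linked:
  assumes X: "locally_compact_Polish X" and G: "pseudogroup X G" and H: "pseudogroup Y H"
    and L: "linked X G Y H \<Phi>"
    and d': "compatible_metric Y d'" and S': "pseudostargroup Y S'" "generates Y S' H"
  obtains d S \<Psi> where "compatible_metric X d" "pseudostargroup X S" "generates X S G"
    "\<Psi> \<subseteq> \<Phi>" "(\<Union>\<psi>\<in>\<Psi>. dom \<psi>) = topspace X"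
    "\<And>c. 0 < c \<Longrightarrow> \<exists>c'>0. \<forall>\<psi>\<in>\<Psi>. \<forall>x y. \<psi> x = Some y \<and> stable_point S' d' c' y \<longrightarrow> stable_point S d c x"
proof -
  obtain U :: "nat \<Rightarrow> 'a set" and \<phi> :: "nat \<Rightarrow> 'a \<rightharpoonup> 'b"
    where \<phi>: "\<And>n. \<phi> n \<in> \<Phi>" and U: "\<And>n. openin X (U n)" "\<And>n. compactin X (X closure_of U n)"
      "\<And>n. X closure_of U n \<subseteq> dom (\<phi> n)" "(\<Union>n. U n) = topspace X" "locally_finite_family X U"
    using linked_locally_finite_cover[OF X L] by metis
  have Ph: "\<phi> n \<in> Ph X Y" for n
    using linkedD(1)[OF L \<phi>] .
  have "metrizable_space X"
    using X completely_metrizable_imp_metrizable_space by (auto simp: locally_compact_Polish_def)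
  from metric_controlled_by_charts[OF this d' Ph U] obtain d where d: "compatible_metric X d"
    and control: "\<And>c. 0 < c \<Longrightarrow> \<exists>c'>0. \<forall>n. \<forall>x\<in>U n. \<forall>y\<in>U n.
       d' (the (\<phi> n x)) (the (\<phi> n y)) < ennreal c' \<longrightarrow> d x y < ennreal c"
    by metis
  define \<psi> where "\<psi> n = \<phi> n |` U n" for n
  have \<psi>: "\<psi> n \<in> \<Phi>" for n
    unfolding \<psi>_def using linkedD(3)[OF L \<phi> U(1)] .
  have \<psi>Ph: "\<psi> n \<in> Ph X Y" for n
    using linkedD(1)[OF L \<psi>] .
  have dom: "dom (\<psi> n) = U n" for n
    using closure_of_subset[OF openin_subset[OF U(1)]] U(3)[of n] by (auto simp: \<psi>_def)
  let ?T = "chart_maps G S' \<psi>" and ?I = "{pid X |` W | W. openin X W}"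
  let ?S = "?T \<union> ?I"
  have S: "pseudostargroup X ?S"
    using pseudostargroup_chart_maps[OF G S'(1) \<psi>Ph] .
  have gen: "generates X ?S G"
    unfolding generates_iff_locally_in[OF G S]
  proof (intro conjI ballI)
    show "?S \<subseteq> G"
      using pseudogroup_restrict[OF G pseudogroupD(2)[OF G]] by (auto simp: chart_maps_def)
    fix g assume "g \<in> G"
    then have "locally_in X ?T g"
      using locally_in_chart_maps[OF G H L S' \<phi> U(1,3,4,5)] unfolding \<psi>_def by blast
    then show "locally_in X ?S g"
      unfolding locally_in_def by blast
  qed
  have stable: "\<exists>c'>0. \<forall>\<theta>\<in>range \<psi>. \<forall>x y. \<theta> x = Some y \<and> stable_point S' d' c' y \<longrightarrow> stable_point ?S d c x"
    if c: "0 < c" for c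
  proof -
    obtain c' where c': "0 < c'" and c'_le: "\<And>n x y. \<lbrakk>x \<in> U n; y \<in> U n;
        d' (the (\<phi> n x)) (the (\<phi> n y)) < ennreal c'\<rbrakk> \<Longrightarrow> d x y < ennreal c"
      using control[OF c] by blast
    have "stable_point ?S d c x" if y: "\<psi> i x = Some y" and st: "stable_point S' d' c' y" for i x y
    proof -
      have top: "x \<in> topspace X" "y \<in> topspace Y"
        using Ph_SomeD[OF \<psi>Ph y] by auto
      obtain r' where r': "0 < r'" and r'_le: "\<And>s y' u v. \<lbrakk>s \<in> S'; s y = Some u; s y' = Some v;
          d' y y' < ennreal r'\<rbrakk> \<Longrightarrow> d' u v < ennreal c'"
        using st unfolding stable_point_def by blast
      let ?B = "pimage (pinv (\<psi> i)) (ext_ball (topspace Y) d' y r')"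
      have "openin X ?B"
        using Ph_openin_preimage[OF \<psi>Ph openin_ext_ball[OF d' top(2) r']] .
      moreover have "x \<in> ?B"
        using center_in_ext_ball[OF d' top(2) r'] y by (auto simp: pimage_iff Ph_pinv_iff[OF \<psi>Ph])
      ultimately obtain r where r: "0 < r" "ext_ball (topspace X) d x r \<subseteq> ?B"
        using ext_ball_subset_openin[OF d] by metis
      (* Restrictions of the identity do not shrink distances, so the radius must not exceed c. *)
      have "d z z' < ennreal c"
        if s: "s \<in> ?S" "s x = Some z" "s x' = Some z'" "d x x' < ennreal (min r c)" for s x' z z'
        using s(1)
      proof
        assume "s \<in> ?I"
        then have "z = x" "z' = x'"
          using s(2,3) by (auto simp: pmap_simps)
        then show ?thesis
          using order_less_le_trans[OF s(4) ennreal_leI[of "min r c" c]] by simp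
      next
        assume sT: "s \<in> ?T"
        have "s \<in> Ph X X"
          using pseudostargroupD(1)[OF S] s(1) by blast
        then have "x' \<in> topspace X"
          using Ph_SomeD s(3) by metis
        moreover have "d x x' < ennreal r"
          using s(4) by (rule order_less_le_trans) (simp add: ennreal_leI)
        ultimately have "x' \<in> ?B"
          using r(2) by (auto simp: ext_ball_def)
        then obtain y' where y': "\<psi> i x' = Some y'" "d' y y' < ennreal r'"
          by (auto simp: pimage_iff Ph_pinv_iff[OF \<psi>Ph] ext_ball_def)
        obtain j where j: "ran s \<subseteq> U j"
          using sT by (auto simp: chart_maps_def dom)
        have z: "z \<in> U j" "z' \<in> U j"
          using j s(2,3) by (auto simp: ran_def)
        then obtain v v' where v: "\<psi> j z = Some v" "\<psi> j z' = Some v'"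
          unfolding dom[symmetric] by blast
        have "\<psi> j \<circ>\<^sub>m s \<circ>\<^sub>m pinv (\<psi> i) \<in> S'"
          using sT by (simp add: chart_maps_def)
        then have "d' v v' < ennreal c'"
        proof (rule r'_le)
          show "(\<psi> j \<circ>\<^sub>m s \<circ>\<^sub>m pinv (\<psi> i)) y = Some v" "(\<psi> j \<circ>\<^sub>m s \<circ>\<^sub>m pinv (\<psi> i)) y' = Some v'"
            using y y'(1) s(2,3) v by (auto simp: map_comp_Some_iff Ph_pinv_iff[OF \<psi>Ph])
        qed (rule y'(2))
        then show ?thesis
          using v z by (intro c'_le[of _ j]) (auto simp: \<psi>_def)
      qed
      moreover have "0 < min r c"
        using r(1) c by simp
      ultimately show ?thesis
        unfolding stable_point_def by blast
    qed
    then show ?thesis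
      using c' by blast
  qed
  have sub: "range \<psi> \<subseteq> \<Phi>"
    using \<psi> by blast
  have cov: "(\<Union>\<theta>\<in>range \<psi>. dom \<theta>) = topspace X"
    using U(4) dom by simp
  show ?thesis
    by (rule that[OF d S gen sub cov stable])
qed

text \<open>
  A stable point of \<open>Y\<close> may lie outside the images of the charts in \<open>\<Psi>\<close>, but its orbit under \<open>S'\<close> meets
  one of them, and stability at the same scale passes along the orbit.
\<close>
lemma sensitive_linked:
  assumes X: "locally_compact_Polish X" and G: "pseudogroup X G" and H: "pseudogroup Y H"
    and L: "linked X G Y H \<Phi>" and sens: "sensitive X G"
  shows "sensitive Y H"
proof (rule ccontr)
  assume "\<not> sensitive Y H"
  then obtain d' S' where d': "compatible_metric Y d'" and S': "pseudostargroup Y S'" "generates Y S' H"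
    and ex: "\<forall>c>0. \<exists>y\<in>topspace Y. stable_point S' d' c y"
    unfolding not_sensitive_iff by (elim exE conjE)
  obtain d S \<Psi> where d: "compatible_metric X d" and S: "pseudostargroup X S" "generates X S G"
    and \<Psi>: "\<Psi> \<subseteq> \<Phi>" "(\<Union>\<psi>\<in>\<Psi>. dom \<psi>) = topspace X"
    and stable: "\<And>c. 0 < c \<Longrightarrow> \<exists>c'>0. \<forall>\<psi>\<in>\<Psi>. \<forall>x y. \<psi> x = Some y \<and> stable_point S' d' c' y
      \<longrightarrow> stable_point S d c x"
    using stable_points_linked[OF X G H L d' S'] by metis
  have "\<exists>x\<in>topspace X. stable_point S d c x" if c: "0 < c" for c
  proof -
    obtain c' where c': "0 < c'" "\<forall>\<psi>\<in>\<Psi>. \<forall>x y. \<psi> x = Some y \<and> stable_point S' d' c' y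
      \<longrightarrow> stable_point S d c x"
      using stable[OF c] by blast
    obtain y where y: "y \<in> topspace Y" "stable_point S' d' c' y"
      using ex c'(1) by blast
    obtain \<phi> x where \<phi>: "\<phi> \<in> \<Phi>" "\<phi> x = Some y"
      using y(1) unfolding linkedD(5)[OF L, symmetric] by (auto simp: ran_def)
    have \<phi>Ph: "\<phi> \<in> Ph X Y"
      using linkedD(1)[OF L \<phi>(1)] .
    have x: "x \<in> topspace X"
      using Ph_SomeD[OF \<phi>Ph \<phi>(2)] by blast
    then obtain \<psi> z where \<psi>: "\<psi> \<in> \<Psi>" "\<psi> x = Some z"
      using \<Psi>(2) by blast
    let ?h = "\<psi> \<circ>\<^sub>m pid X \<circ>\<^sub>m pinv \<phi>"
    have "?h \<in> H"
      using linkedD(6)[OF L \<phi>(1) _ pseudogroupD(2)[OF G]] \<Psi>(1) \<psi>(1) by blast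
    then have "locally_in Y S' ?h"
      using S' generates_iff_locally_in[OF H S'(1)] by blast
    moreover have hy: "?h y = Some z"
      using \<phi>(2) \<psi>(2) x by (auto simp: pmap_simps Ph_pinv_iff[OF \<phi>Ph])
    ultimately obtain V where V: "y \<in> V" "?h |` V \<in> S'"
      using locally_inE[of Y S' ?h y] by blast
    have "(?h |` V) y = Some z"
      using hy V(1) by (simp add: restrict_eq_Some_iff)
    then have "stable_point S' d' c' z"
      by (rule stable_point_orbit[OF d' S'(1) y(2) V(2)])
    then show ?thesis
      using c'(2) \<psi> x by blast
  qed
  then have "\<not> sensitive X G"
    unfolding not_sensitive_iff using d S by blast
  with sens show False
    by contradiction
qed

lemma almost_equicontinuous_linked:
  assumes X: "locally_compact_Polish X" and G: "pseudogroup X G" and H: "pseudogroup Y H"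
    and L: "linked X G Y H \<Phi>" and ae: "almost_equicontinuous Y H"
  shows "almost_equicontinuous X G"
proof -
  obtain d' S' where d': "compatible_metric Y d'" and S': "pseudostargroup Y S'" "generates Y S' H"
    and dense: "Y closure_of {y \<in> topspace Y. \<forall>c>0. stable_point S' d' c y} = topspace Y"
    using ae unfolding almost_equicontinuous_iff[OF H] by (elim exE conjE)
  obtain d S \<Psi> where d: "compatible_metric X d" and S: "pseudostargroup X S" "generates X S G"
    and \<Psi>: "\<Psi> \<subseteq> \<Phi>" "(\<Union>\<psi>\<in>\<Psi>. dom \<psi>) = topspace X"
    and stable: "\<And>c. 0 < c \<Longrightarrow> \<exists>c'>0. \<forall>\<psi>\<in>\<Psi>. \<forall>x y. \<psi> x = Some y \<and> stable_point S' d' c' y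
      \<longrightarrow> stable_point S d c x"
    using stable_points_linked[OF X G H L d' S'] by metis
  have "{x \<in> topspace X. \<forall>c>0. stable_point S d c x} \<inter> A \<noteq> {}" if A: "openin X A" "A \<noteq> {}" for A
  proof -
    obtain x where x: "x \<in> A" "x \<in> topspace X"
      using A openin_subset by blast
    then obtain \<psi> y where \<psi>: "\<psi> \<in> \<Psi>" "\<psi> x = Some y"
      using \<Psi>(2) by blast
    have Ph: "\<psi> \<in> Ph X Y"
      using linkedD(1)[OF L] \<Psi>(1) \<psi>(1) by blast
    have "openin Y (pimage \<psi> A)" "pimage \<psi> A \<noteq> {}"
      using Ph_openin_pimage[OF Ph A(1)] x(1) \<psi>(2) by (auto simp: pimage_def)
    then obtain v where v: "v \<in> pimage \<psi> A" "\<forall>c>0. stable_point S' d' c v"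
      using dense unfolding dense_intersects_open by blast
    then obtain u where u: "u \<in> A" "\<psi> u = Some v"
      by (auto simp: pimage_iff)
    have "stable_point S d c u" if "0 < c" for c
      using stable[OF that] v(2) u(2) \<psi>(1) by blast
    then show ?thesis
      using u(1) A(1) openin_subset by blast
  qed
  then have "X closure_of {x \<in> topspace X. \<forall>c>0. stable_point S d c x} = topspace X"
    unfolding dense_intersects_open by blast
  then show ?thesis
    unfolding almost_equicontinuous_iff[OF G] using d S by blast
qed

theorem theorem1p9:
  fixes X :: "'a topology" and Y :: "'b topology"
    and G :: "('a \<rightharpoonup> 'a) set" and H :: "('b \<rightharpoonup> 'b) set"
    and \<Phi> :: "('a \<rightharpoonup> 'b) set"
  assumes "locally_compact_Polish X" and "locally_compact_Polish Y"
    and "pseudogroup X G" and "pseudogroup Y H"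
    and "pseudogroup_equivalence X G Y H \<Phi>"
  shows "(sensitive X G \<longleftrightarrow> sensitive Y H) \<and>
    (density_of_periodic_orbits X G \<longleftrightarrow> density_of_periodic_orbits Y H) \<and>
    (chaotic X G \<longleftrightarrow> chaotic Y H) \<and>
    (almost_equicontinuous X G \<longleftrightarrow> almost_equicontinuous Y H)"
proof -
  note X = assms(1) and Y = assms(2) and G = assms(3) and H = assms(4)
  have L: "linked X G Y H \<Phi>"
    using pseudogroup_equivalence_imp_linked[OF G H assms(5)] .
  have L': "linked Y H X G (pinv ` \<Phi>)"
    using linked_sym[OF L] .
  have sens: "sensitive X G \<longleftrightarrow> sensitive Y H"
    using sensitive_linked[OF X G H L] sensitive_linked[OF Y H G L'] by iprover
  have dens: "density_of_periodic_orbits X G \<longleftrightarrow> density_of_periodic_orbits Y H"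
    using density_of_periodic_orbits_linked[OF X G H L]
      density_of_periodic_orbits_linked[OF Y H G L'] by iprover
  have "topologically_transitive X G \<longleftrightarrow> topologically_transitive Y H"
    using topologically_transitive_linked[OF L] topologically_transitive_linked[OF L'] by iprover
  with sens dens have "chaotic X G \<longleftrightarrow> chaotic Y H"
    by (simp add: chaotic_def)
  moreover have "almost_equicontinuous X G \<longleftrightarrow> almost_equicontinuous Y H"
    using almost_equicontinuous_linked[OF X G H L]
      almost_equicontinuous_linked[OF Y H G L'] by iprover
  ultimately show ?thesis
    using sens dens by iprover
qed

end
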